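(* Let $\lambda_1,\lambda_2\in\mathbb{R}$ satisfy $0<|\lambda_1|<1<|\lambda_2|$, let $\Lambda:=\mathrm{diag}(\lambda_1,\lambda_2)$, $\alpha\in(0,1]$, $\sigma:=\log|\lambda_2|/\log|\lambda_1|<0$, and $$\beta_*:=\begin{cases}-\sigma(1-\sigma)^{-1}\alpha, & \text{if } |\lambda_1\lambda_2|\le 1,\\ (1-\sigma)^{-1}\alpha, & \text{if } |\lambda_1\lambda_2|>1.\end{cases}$$ Then $\beta_*$ is a sharp upper bound of the exponent $\beta$ for $C^{1,\beta}$ linearization, in the following sense: there exists a mapping $F:\mathbb{R}^2\to\mathbb{R}^2$ which is a $C^{1,\alpha}$ diffeomorphism in a neighborhood of the origin $O$ (onto its image), with $F(O)=O$ and $DF(O)=\Lambda$, such that whenever $\beta\in(0,1]$ and $\Phi$ is a $C^{1,\beta}$ diffeomorphism from a neighborhood of $O$ onto its image satisfying $\Phi\circ F=\Lambda\circ\Phi$ near $O$, one has $\beta\le\beta_*$.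
   Context: For $\gamma\in(0,1]$, a mapping $G$ is $C^{1,\gamma}$ if it is $C^1$ and $\sup_{x\ne y}\|DG(x)-DG(y)\|/\|x-y\|^{\gamma}<\infty$ on the region considered. The paper also shows that every $C^{1,\alpha}$ diffeomorphism $F$ with $F(O)=O$, $DF(O)=\Lambda$ admits a $C^{1,\beta_*}$ linearization near $O$; the present statement says that the exponent $\beta_*$ cannot be improved in general. *)

theory Defs
  imports "HOL-Analysis.Analysis"
begin

definition C1_holder_on :: "real \<Rightarrow> 'a set \<Rightarrow> ('a::real_normed_vector \<Rightarrow> 'b::real_normed_vector) \<Rightarrow> bool"
  where "C1_holder_on \<gamma> U G \<longleftrightarrow>
    (\<exists>DG :: 'a \<Rightarrow> ('a \<Rightarrow>\<^sub>L 'b).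
       (\<forall>x\<in>U. (G has_derivative blinfun_apply (DG x)) (at x)) \<and>
       continuous_on U DG \<and>
       (\<exists>C. \<forall>x\<in>U. \<forall>y\<in>U. x \<noteq> y \<longrightarrow> norm (DG x - DG y) / norm (x - y) powr \<gamma> \<le> C))"

text \<open>
  The inverse is required to be of the same class. Near a given point this asks no more than
  a \<open>C\<^sup>1\<close> inverse: on a smaller convex neighbourhood with bounded inverse derivative, the Hoelder
  bound for the derivative of the inverse is automatic.
\<close>
definition C1_holder_diffeo_on :: "real \<Rightarrow> 'a set \<Rightarrow> ('a::real_normed_vector \<Rightarrow> 'b::real_normed_vector) \<Rightarrow> bool"
  where "C1_holder_diffeo_on \<gamma> U G \<longleftrightarrow>
    open U \<and> open (G ` U) \<and> inj_on G U \<and>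
    C1_holder_on \<gamma> U G \<and> C1_holder_on \<gamma> (G ` U) (inv_into U G)"

definition diag2 :: "real \<Rightarrow> real \<Rightarrow> real^2^2"
  where "diag2 a b = vector [vector [a, 0], vector [0, b]]"

definition sigma :: "real \<Rightarrow> real \<Rightarrow> real"
  where "sigma l1 l2 = ln \<bar>l2\<bar> / ln \<bar>l1\<bar>"

definition beta_star :: "real \<Rightarrow> real \<Rightarrow> real \<Rightarrow> real"
  where "beta_star l1 l2 \<alpha> =
    (if \<bar>l1 * l2\<bar> \<le> 1 then - sigma l1 l2 * inverse (1 - sigma l1 l2) * \<alpha>
     else inverse (1 - sigma l1 l2) * \<alpha>)"

end

theory Submission
  imports Defs
begin

text \<open>
  Let \<open>q\<close> be the axis of the eigenvalue whose logarithm is smaller in modulus, and \<open>p\<close> the other one;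
  write \<open>P = \<bar>ln \<bar>l p\<bar>\<bar>\<close> and \<open>Q = \<bar>ln \<bar>l q\<bar>\<bar>\<close>, so that \<open>beta_star = \<alpha> Q / (P + Q)\<close>.
  The map \<open>F\<close> is \<open>\<Lambda>\<close> with \<open>x\<close> replaced by \<open>x + y\<^sup>1\<^sup>+\<^sup>\<alpha> b (x / y)\<close> in the \<open>p\<close>-component, for \<open>y > 0\<close>,
  where \<open>b\<close> is a bump supported so close to \<open>1\<close> that an orbit meets the cone \<open>x / y \<in> supp b\<close> at most once.
  The perturbation is homogeneous of degree \<open>1 + \<alpha>\<close>, hence \<open>F\<close> is of class \<open>C\<^sup>1\<^sup>,\<^sup>\<alpha>\<close>.

  Let \<open>f\<close> be the \<open>p\<close>-component of a \<open>C\<^sup>1\<^sup>,\<^sup>\<beta>\<close> linearization and \<open>a \<noteq> 0\<close> its \<open>x\<close>-derivative at the origin.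
  Near the axes \<open>F\<close> is linear, and the conjugacy forces \<open>f (x, 0) = a x\<close>, \<open>f (0, y) = 0\<close> and
  \<open>\<partial>\<^sub>x f (0, y) = a\<close>; thus \<open>f (x, y) / x - a\<close> is \<open>O(\<bar>y\<bar> / \<bar>x\<bar>)\<close> and \<open>O(\<bar>x\<bar>\<^sup>\<beta>)\<close>.
  Along the orbit of \<open>(s, s)\<close> the quotient \<open>f (x, y) / x\<close> is constant except at the cone, where \<open>x\<close> gains
  the factor \<open>1 + s\<^sup>\<alpha>\<close>. Following the orbit to unit distance in both time directions
  yields \<open>\<bar>a\<bar> s\<^sup>\<alpha> = O(x\<^sup>\<beta> + y)\<close>, where \<open>x\<close> is of order \<open>s\<close> to the power \<open>1 + P / Q\<close>
  and \<open>y\<close> of order \<open>s\<close> to the power \<open>1 + Q / P\<close>.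
  As \<open>\<alpha> < 1 + Q / P\<close>, letting \<open>s\<close> tend to \<open>0\<close> gives \<open>\<beta> (1 + P / Q) \<le> \<alpha>\<close>.
\<close>

section \<open>Hoelder continuously differentiable maps\<close>

text \<open>Continuity of \<open>DG\<close> comes with the Hoelder bound, whose right-hand side
  tends to 0 because \<gamma> is positive.\<close>

lemma C1_holder_onI:
  assumes "0 < \<gamma>"
    and der: "\<And>x. x \<in> U \<Longrightarrow> (G has_derivative blinfun_apply (DG x)) (at x)"
    and holder: "\<And>x y. x \<in> U \<Longrightarrow> y \<in> U \<Longrightarrow> norm (DG x - DG y) \<le> C * norm (x - y) powr \<gamma>"
  shows "C1_holder_on \<gamma> U G"
proof -
  have "((\<lambda>y. DG y) \<longlongrightarrow> DG x) (at x within U)" if x: "x \<in> U" for x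
  proof (rule Lim_null_comparison [where g = "\<lambda>y. C * norm (y - x) powr \<gamma>", THEN Lim_null [THEN iffD2]])
    show "\<forall>\<^sub>F y in at x within U. norm (DG y - DG x) \<le> C * norm (y - x) powr \<gamma>"
      using holder x by (auto simp: eventually_at_filter)
    have "((\<lambda>y. norm (y - x)) \<longlongrightarrow> norm (x - x)) (at x within U)"
      by (intro tendsto_intros)
    then have "((\<lambda>y. norm (y - x) powr \<gamma>) \<longlongrightarrow> 0) (at x within U)"
      using tendsto_powr2 [OF _ tendsto_const, of _ 0 _ \<gamma>] \<open>0 < \<gamma>\<close> by fastforce
    then show "((\<lambda>y. C * norm (y - x) powr \<gamma>) \<longlongrightarrow> 0) (at x within U)"
      by (rule tendsto_mult_right_zero)
  qed
  then have "continuous_on U DG"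
    by (simp add: continuous_on_def)
  moreover have "norm (DG x - DG y) / norm (x - y) powr \<gamma> \<le> C" if "x \<in> U" "y \<in> U" "x \<noteq> y" for x y
    using holder [OF that(1,2)] that(3) by (simp add: divide_le_eq)
  ultimately show ?thesis
    unfolding C1_holder_on_def using der by blast
qed

lemma C1_holder_onE:
  assumes "C1_holder_on \<gamma> U G"
  obtains DG :: "'a::real_normed_vector \<Rightarrow> ('a \<Rightarrow>\<^sub>L 'b::real_normed_vector)" and C
  where "0 \<le> C" "continuous_on U DG"
    "\<And>x. x \<in> U \<Longrightarrow> (G has_derivative blinfun_apply (DG x)) (at x)"
    "\<And>x y. x \<in> U \<Longrightarrow> y \<in> U \<Longrightarrow> norm (DG x - DG y) \<le> C * norm (x - y) powr \<gamma>"
proof -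
  obtain DG :: "'a \<Rightarrow> ('a \<Rightarrow>\<^sub>L 'b)" and C where
    der: "\<forall>x\<in>U. (G has_derivative blinfun_apply (DG x)) (at x)" and cont: "continuous_on U DG"
    and C: "\<forall>x\<in>U. \<forall>y\<in>U. x \<noteq> y \<longrightarrow> norm (DG x - DG y) / norm (x - y) powr \<gamma> \<le> C"
    using assms unfolding C1_holder_on_def by blast
  show ?thesis
  proof (rule that [of "max C 0" DG])
    fix x y assume xy: "x \<in> U" "y \<in> U"
    show "norm (DG x - DG y) \<le> max C 0 * norm (x - y) powr \<gamma>"
    proof (cases "x = y")
      case False
      then have "norm (DG x - DG y) / norm (x - y) powr \<gamma> \<le> max C 0"
        using C xy by (auto simp: le_max_iff_disj)
      then show ?thesis
        using False by (simp add: divide_le_eq)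
    qed simp
  qed (use der cont in auto)
qed

text \<open>The inverse function theorem with Hoelder control. Near \<open>x0\<close> the map
  expands distances by at least a factor \<open>b\<close>, so it is injective, has open image by
  invariance of domain, and has a Lipschitz inverse; the derivative of the inverse then inherits the
  Hoelder bound.\<close>

lemma C1_holder_local_diffeo:
  fixes G :: "'a::euclidean_space \<Rightarrow> 'a"
  assumes G: "C1_holder_on \<gamma> U G" and "0 < \<gamma>" and "open U" and x0: "x0 \<in> U"
    and D: "(G has_derivative D) (at x0)" and "inj D"
  shows "\<exists>V. x0 \<in> V \<and> C1_holder_diffeo_on \<gamma> V G"
proof -
  obtain DG :: "'a \<Rightarrow> ('a \<Rightarrow>\<^sub>L 'a)" and C where C: "0 \<le> C" and cont: "continuous_on U DG"
    and der: "\<And>x. x \<in> U \<Longrightarrow> (G has_derivative blinfun_apply (DG x)) (at x)"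
    and holder: "\<And>x y. x \<in> U \<Longrightarrow> y \<in> U \<Longrightarrow> norm (DG x - DG y) \<le> C * norm (x - y) powr \<gamma>"
    using C1_holder_onE [OF G] by metis
  have D_eq: "D = DG x0"
    using D der [OF x0] has_derivative_unique by blast
  have "linear D"
    unfolding D_eq by (rule bounded_linear.linear [OF blinfun.bounded_linear_right])
  then obtain B where B: "B > 0" "\<And>v. B * norm v \<le> norm (D v)"
    using linear_inj_bounded_below_pos \<open>inj D\<close> by metis
  \<comment> \<open>One half of the lower bound \<open>B\<close> for \<open>D\<close> may be lost to
    the variation of \<open>DG\<close> on the ball; the other half remains as the expansion
    factor.\<close>
  define b where "b = B / 2"
  have b: "b > 0"
    using B by (simp add: b_def)
  have "\<forall>\<^sub>F x in at x0. dist (DG x) (DG x0) < b"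
    using cont \<open>open U\<close> x0 b by (metis continuous_on_eq_continuous_at isCont_def tendstoD)
  moreover have "\<forall>\<^sub>F x in at x0. x \<in> U"
    using \<open>open U\<close> x0 by (simp add: eventually_at_in_open')
  ultimately have "\<forall>\<^sub>F x in at x0. dist (DG x) (DG x0) < b \<and> x \<in> U"
    by (rule eventually_conj)
  then obtain e where e: "e > 0"
    "\<And>x. x \<noteq> x0 \<Longrightarrow> dist x x0 < e \<Longrightarrow> dist (DG x) (DG x0) < b \<and> x \<in> U"
    unfolding eventually_at by auto
  define V where "V = ball x0 e"
  have VU: "x \<in> U" and near: "norm (DG x - DG x0) \<le> b" if "x \<in> V" for x
    using e(2) [of x] that x0 b by (cases "x = x0"; force simp: V_def dist_norm norm_minus_commute)+
  have lower: "b * norm v \<le> norm (DG x v)" if "x \<in> V" for x v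
  proof -
    have "norm ((DG x - DG x0) v) \<le> b * norm v"
      using norm_blinfun [of "DG x - DG x0" v] near [OF that]
      by (meson mult_right_mono norm_ge_zero order_trans)
    moreover have "2 * b * norm v \<le> norm (DG x0 v)"
      using B(2) [of v] by (simp add: b_def D_eq)
    moreover have "norm (DG x0 v) \<le> norm (DG x v) + norm ((DG x - DG x0) v)"
      using norm_triangle_ineq4 [of "DG x v" "(DG x - DG x0) v"] by (simp add: blinfun.diff_left)
    ultimately show ?thesis
      by linarith
  qed
  have expand: "b * norm (x - y) \<le> norm (G x - G y)" if "x \<in> V" "y \<in> V" for x y
  proof -
    have "norm ((G x - DG x0 x) - (G y - DG x0 y)) \<le> b * norm (x - y)"
    proof (rule differentiable_bound [of V])
      show "((\<lambda>x. G x - DG x0 x) has_derivative blinfun_apply (DG z - DG x0)) (at z within V)" if "z \<in> V" for z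
        unfolding blinfun.diff_left
        by (intro has_derivative_diff has_derivative_at_withinI [OF der] VU that
            bounded_linear_imp_has_derivative blinfun.bounded_linear_right)
      show "onorm (blinfun_apply (DG z - DG x0)) \<le> b" if "z \<in> V" for z
        using near [OF that] by (simp add: norm_blinfun.rep_eq)
    qed (use that in \<open>auto simp: V_def\<close>)
    moreover have "2 * b * norm (x - y) \<le> norm (DG x0 (x - y))"
      using B(2) [of "x - y"] by (simp add: b_def D_eq)
    moreover have "norm (DG x0 (x - y)) \<le> norm (G x - G y) + norm ((G x - DG x0 x) - (G y - DG x0 y))"
      using norm_triangle_ineq4 [of "G x - G y" "(G x - DG x0 x) - (G y - DG x0 y)"]
      by (simp add: blinfun.diff_right algebra_simps)
    ultimately show ?thesis
      by linarith
  qed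
  have "open V" and "x0 \<in> V"
    using e by (auto simp: V_def)
  have inj: "inj_on G V"
    using expand b by (fastforce simp: inj_on_def mult_le_0_iff)
  have "continuous_on V G"
    using der VU has_derivative_continuous by (metis continuous_at_imp_continuous_on)
  then have openG: "open (G ` V)"
    using invariance_of_domain \<open>open V\<close> inj by blast
  have "\<exists>J :: 'a \<Rightarrow>\<^sub>L 'a. (\<forall>v. J (DG x v) = v) \<and> (\<forall>v. DG x (J v) = v)" if "x \<in> V" for x
  proof -
    have "inj (DG x)"
    proof (rule injI)
      fix u v assume "DG x u = DG x v"
      then have "b * norm (u - v) \<le> 0"
        using lower [OF that, of "u - v"] by (simp add: blinfun.diff_right)
      then show "u = v"
        using b by (simp add: mult_le_0_iff)
    qed
    then obtain J where J: "linear J" "\<forall>v. J (DG x v) = v" "\<forall>v. DG x (J v) = v"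
      using linear_injective_isomorphism [OF bounded_linear.linear [OF blinfun.bounded_linear_right]] by metis
    then have "blinfun_apply (Blinfun J) = J"
      by (simp add: bounded_linear_Blinfun_apply linear_conv_bounded_linear)
    then show ?thesis
      using J by (intro exI [of _ "Blinfun J"]) simp
  qed
  then obtain J :: "'a \<Rightarrow> ('a \<Rightarrow>\<^sub>L 'a)"
    where J1: "\<And>x v. x \<in> V \<Longrightarrow> J x (DG x v) = v" and J2: "\<And>x v. x \<in> V \<Longrightarrow> DG x (J x v) = v"
    by metis
  have Jb: "norm (J x v) \<le> norm v / b" if "x \<in> V" for x v
    using lower [OF that, of "J x v"] J2 [OF that] b by (simp add: field_simps)
  have Jd: "norm (J x - J y) \<le> norm (DG x - DG y) / b\<^sup>2" if "x \<in> V" "y \<in> V" for x y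
  proof (rule norm_blinfun_bound)
    fix w
    \<comment> \<open>The resolvent identity; each of the two outer inverses costs a factor
      \<open>1 / b\<close>.\<close>
    have "(J x - J y) w = J x ((DG y - DG x) (J y w))"
      by (simp add: blinfun.diff_left blinfun.diff_right J1 J2 that)
    also have "norm \<dots> \<le> norm ((DG y - DG x) (J y w)) / b"
      by (rule Jb [OF that(1)])
    also have "\<dots> \<le> norm (DG y - DG x) * (norm w / b) / b"
      using b by (intro divide_right_mono order_trans [OF norm_blinfun] mult_left_mono Jb that) auto
    finally show "norm ((J x - J y) w) \<le> norm (DG x - DG y) / b\<^sup>2 * norm w"
      by (simp add: power2_eq_square norm_minus_commute)
  qed simp
  let ?g = "inv_into V G"
  have gV: "?g z \<in> V" and Gg: "G (?g z) = z" if "z \<in> G ` V" for z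
    using that by (auto simp: inv_into_into f_inv_into_f)
  have g_lip: "norm (?g z - ?g w) \<le> norm (z - w) / b" if "z \<in> G ` V" "w \<in> G ` V" for z w
    using expand [OF gV gV, OF that] Gg that b by (simp add: field_simps)
  have "C1_holder_on \<gamma> (G ` V) ?g"
  proof (rule C1_holder_onI [OF \<open>0 < \<gamma>\<close>])
    fix z assume z: "z \<in> G ` V"
    have "(?g \<longlongrightarrow> ?g z) (at z)"
    proof (rule Lim_null_comparison [where g = "\<lambda>w. norm (w - z) / b", THEN Lim_null [THEN iffD2]])
      show "\<forall>\<^sub>F w in at z. norm (?g w - ?g z) \<le> norm (w - z) / b"
        using eventually_at_in_open' [OF openG z] by eventually_elim (simp add: g_lip z)
      have "((\<lambda>w. norm (w - z) / b) \<longlongrightarrow> norm (z - z) / b) (at z)"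
        using b by (intro tendsto_intros) auto
      then show "((\<lambda>w. norm (w - z) / b) \<longlongrightarrow> 0) (at z)"
        by simp
    qed
    then have "isCont ?g z"
      by (simp add: isCont_def)
    show "(?g has_derivative blinfun_apply (J (?g z))) (at z)"
    proof (rule has_derivative_inverse_basic)
      show "(G has_derivative blinfun_apply (DG (?g z))) (at (?g z))"
        by (intro der VU gV z)
      show "blinfun_apply (J (?g z)) \<circ> blinfun_apply (DG (?g z)) = id"
        using J1 [OF gV [OF z]] by (simp add: fun_eq_iff)
    qed (fact blinfun.bounded_linear_right \<open>isCont ?g z\<close> openG z Gg)+
  next
    fix z w assume zw: "z \<in> G ` V" "w \<in> G ` V"
    have "norm (J (?g z) - J (?g w)) \<le> norm (DG (?g z) - DG (?g w)) / b\<^sup>2"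
      by (intro Jd gV zw)
    also have "\<dots> \<le> C * norm (?g z - ?g w) powr \<gamma> / b\<^sup>2"
      by (intro divide_right_mono holder VU gV zw) auto
    also have "\<dots> \<le> C * (norm (z - w) / b) powr \<gamma> / b\<^sup>2"
      using C \<open>0 < \<gamma>\<close> by (intro divide_right_mono mult_left_mono powr_mono2 g_lip zw) auto
    also have "\<dots> = C / (b powr \<gamma> * b\<^sup>2) * norm (z - w) powr \<gamma>"
      using b by (simp add: powr_divide)
    finally show "norm (J (?g z) - J (?g w)) \<le> C / (b powr \<gamma> * b\<^sup>2) * norm (z - w) powr \<gamma>" .
  qed
  moreover have "C1_holder_on \<gamma> V G"
    using \<open>0 < \<gamma>\<close> der holder VU by (intro C1_holder_onI [where DG = DG and C = C]) auto
  ultimately show ?thesis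
    using \<open>open V\<close> \<open>x0 \<in> V\<close> openG inj unfolding C1_holder_diffeo_on_def by blast
qed

section \<open>A homogeneous perturbation supported in a cone\<close>

text \<open>The fractions \<open>u / v\<close> and \<open>(v - u) / v\<close> sum to 1, and a number
  in [0, 1] is at most its power with exponent \<open>a\<close>.\<close>

lemma powr_diff_le:
  fixes a u v :: real
  assumes "0 < a" "a \<le> 1" "0 < u" "u \<le> v"
  shows "v powr a - u powr a \<le> (v - u) powr a"
proof -
  have le: "w / v \<le> (w / v) powr a" if "0 \<le> w" "w \<le> v" for w
    using powr_mono' [of a 1 "w / v"] assms that by (simp add: divide_le_eq)
  have "1 = u / v + (v - u) / v"
    using assms by (simp add: field_simps)
  also have "\<dots> \<le> (u / v) powr a + ((v - u) / v) powr a"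
    using assms by (intro add_mono le) auto
  also have "\<dots> = (u powr a + (v - u) powr a) / v powr a"
    using assms by (simp add: powr_divide add_divide_distrib)
  finally show ?thesis
    using assms by (simp add: le_divide_eq)
qed

section \<open>Bounded Lipschitz profiles and the homogeneous functions built from them\<close>

definition bounded_lipschitz :: "(real \<Rightarrow> real) \<Rightarrow> bool"
  where "bounded_lipschitz c \<longleftrightarrow>
    (\<exists>M\<ge>0. \<forall>s t. \<bar>c t\<bar> \<le> M \<and> \<bar>c s - c t\<bar> \<le> M * \<bar>s - t\<bar>)"

lemma bounded_lipschitz_const: "bounded_lipschitz (\<lambda>_. k)"
  unfolding bounded_lipschitz_def by (rule exI [of _ "\<bar>k\<bar>"]) simp

lemma bounded_lipschitz_diff:
  assumes "bounded_lipschitz f" "bounded_lipschitz g"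
  shows "bounded_lipschitz (\<lambda>t. f t - g t)"
proof -
  obtain M N where "0 \<le> M" "0 \<le> N"
    and f: "\<And>s t. \<bar>f t\<bar> \<le> M \<and> \<bar>f s - f t\<bar> \<le> M * \<bar>s - t\<bar>"
    and g: "\<And>s t. \<bar>g t\<bar> \<le> N \<and> \<bar>g s - g t\<bar> \<le> N * \<bar>s - t\<bar>"
    using assms unfolding bounded_lipschitz_def by metis
  have "\<bar>f t - g t\<bar> \<le> M + N \<and> \<bar>(f s - g s) - (f t - g t)\<bar> \<le> (M + N) * \<bar>s - t\<bar>" for s t
    using f [of t s] g [of t s] by (simp add: distrib_right abs_le_iff)
  then show ?thesis
    unfolding bounded_lipschitz_def using \<open>0 \<le> M\<close> \<open>0 \<le> N\<close> by (intro exI [of _ "M + N"]) auto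
qed

lemma bounded_lipschitz_mult:
  assumes "bounded_lipschitz f" "bounded_lipschitz g"
  shows "bounded_lipschitz (\<lambda>t. f t * g t)"
proof -
  obtain M N where "0 \<le> M" "0 \<le> N"
    and f: "\<And>s t. \<bar>f t\<bar> \<le> M \<and> \<bar>f s - f t\<bar> \<le> M * \<bar>s - t\<bar>"
    and g: "\<And>s t. \<bar>g t\<bar> \<le> N \<and> \<bar>g s - g t\<bar> \<le> N * \<bar>s - t\<bar>"
    using assms unfolding bounded_lipschitz_def by metis
  have bd: "\<bar>f t * g t\<bar> \<le> 2 * M * N" for t
  proof -
    have "\<bar>f t * g t\<bar> \<le> M * N"
      unfolding abs_mult using f g \<open>0 \<le> M\<close> by (intro mult_mono) auto
    then show ?thesis
      using \<open>0 \<le> M\<close> \<open>0 \<le> N\<close> mult_nonneg_nonneg [of M N] by linarith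
  qed
  have lip: "\<bar>f s * g s - f t * g t\<bar> \<le> 2 * M * N * \<bar>s - t\<bar>" for s t
  proof -
    have "\<bar>f s * g s - f t * g t\<bar> = \<bar>f s * (g s - g t) + (f s - f t) * g t\<bar>"
      by (simp add: algebra_simps)
    also have "\<dots> \<le> \<bar>f s\<bar> * \<bar>g s - g t\<bar> + \<bar>f s - f t\<bar> * \<bar>g t\<bar>"
      by (metis abs_mult abs_triangle_ineq)
    also have "\<dots> \<le> M * (N * \<bar>s - t\<bar>) + M * \<bar>s - t\<bar> * N"
      using f g \<open>0 \<le> M\<close> \<open>0 \<le> N\<close> by (intro add_mono mult_mono) auto
    finally show ?thesis
      by (simp add: mult_ac)
  qed
  show ?thesis
    unfolding bounded_lipschitz_def using bd lip \<open>0 \<le> M\<close> \<open>0 \<le> N\<close>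
    by (intro exI [of _ "2 * M * N"]) auto
qed

text \<open>Both partial derivatives of the perturbation have this shape. If both heights are at
  most \<open>2 * d\<close>, each value is of order \<open>d powr a\<close>. Otherwise both heights
  exceed \<open>d\<close>, the quotient moves by at most \<open>3 * d / y\<close> where it matters,
  and \<open>d / y \<le> (d / y) powr a\<close> turns this into order
  \<open>d powr a\<close>.\<close>

lemma holder_homogeneous:
  fixes c :: "real \<Rightarrow> real" and a :: real
  defines "f \<equiv> \<lambda>x y. if 0 < y then y powr a * c (x / y) else 0"
  assumes a: "0 < a" "a \<le> 1" and "bounded_lipschitz c" and supp: "\<And>t. 2 \<le> \<bar>t\<bar> \<Longrightarrow> c t = 0"
  shows "\<exists>C\<ge>0. \<forall>x y x' y' d. \<bar>x - x'\<bar> \<le> d \<longrightarrow> \<bar>y - y'\<bar> \<le> d \<longrightarrow> \<bar>f x y - f x' y'\<bar> \<le> C * d powr a"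
proof -
  obtain M where "0 \<le> M" and bd: "\<And>t. \<bar>c t\<bar> \<le> M" and lip: "\<And>s t. \<bar>c s - c t\<bar> \<le> M * \<bar>s - t\<bar>"
    using \<open>bounded_lipschitz c\<close> unfolding bounded_lipschitz_def by metis
  have f_bd: "\<bar>f x y\<bar> \<le> M * (2 * d powr a)" if "y \<le> 2 * d" "0 \<le> d" for x y d
  proof (cases "0 < y")
    case True
    have "y powr a \<le> (2 * d) powr a"
      using True that a by (intro powr_mono2) auto
    also have "\<dots> = 2 powr a * d powr a"
      using that by (simp add: powr_mult)
    also have "\<dots> \<le> 2 * d powr a"
      using powr_mono [of a 1 "2::real"] a by (intro mult_right_mono) auto
    finally have "\<bar>y powr a * c (x / y)\<bar> \<le> (2 * d powr a) * M"
      unfolding abs_mult by (intro mult_mono bd) auto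
    then show ?thesis
      using True by (simp add: f_def mult.commute)
  qed (use \<open>0 \<le> M\<close> in \<open>simp add: f_def\<close>)
  have main: "\<bar>f x y - f x' y'\<bar> \<le> 4 * M * d powr a"
    if "\<bar>x - x'\<bar> \<le> d" "\<bar>y - y'\<bar> \<le> d" "y \<le> y'" for x y x' y' d
  proof (cases "y' \<le> 2 * d")
    case True
    then show ?thesis
      using f_bd [of y d x] f_bd [of y' d x'] that by (auto simp: abs_le_iff)
  next
    case False
    have d: "0 \<le> d" "d < y" and y: "0 < y" "0 < y'"
      using False that by auto
    have tri: "\<bar>(p + t * q) / z\<bar> \<le> (\<bar>p\<bar> + \<bar>t\<bar> * \<bar>q\<bar>) / z" if "0 < z" for p t q z :: real
      using abs_triangle_ineq [of p "t * q"] that by (simp add: abs_mult divide_right_mono)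
    \<comment> \<open>A bounded quotient makes a change of height harmless; if both quotients exceed
      2 in modulus, \<open>c\<close> vanishes at both.\<close>
    have "\<bar>x / y - x' / y'\<bar> \<le> 3 * d / y" if small: "\<bar>x / y\<bar> \<le> 2 \<or> \<bar>x' / y'\<bar> \<le> 2"
      using small
    proof
      assume t: "\<bar>x / y\<bar> \<le> 2"
      have "x / y - x' / y' = ((x - x') + (x / y) * (y' - y)) / y'"
        using y by (simp add: field_simps)
      also have "\<bar>\<dots>\<bar> \<le> (\<bar>x - x'\<bar> + \<bar>x / y\<bar> * \<bar>y' - y\<bar>) / y'"
        by (rule tri) (use y in simp)
      also have "\<dots> \<le> (d + 2 * d) / y'"
        using \<open>\<bar>x - x'\<bar> \<le> d\<close> \<open>\<bar>y - y'\<bar> \<le> d\<close> t y by (intro divide_right_mono add_mono mult_mono) auto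
      also have "\<dots> \<le> 3 * d / y"
        using d y \<open>y \<le> y'\<close> by (auto intro!: divide_left_mono)
      finally show ?thesis .
    next
      assume t: "\<bar>x' / y'\<bar> \<le> 2"
      have "x / y - x' / y' = ((x - x') + (x' / y') * (y' - y)) / y"
        using y by (simp add: field_simps)
      also have "\<bar>\<dots>\<bar> \<le> (\<bar>x - x'\<bar> + \<bar>x' / y'\<bar> * \<bar>y' - y\<bar>) / y"
        by (rule tri) (use y in simp)
      also have "\<dots> \<le> (d + 2 * d) / y"
        using \<open>\<bar>x - x'\<bar> \<le> d\<close> \<open>\<bar>y - y'\<bar> \<le> d\<close> t y by (intro divide_right_mono add_mono mult_mono) auto
      finally show ?thesis by simp
    qed
    then have "M * \<bar>x / y - x' / y'\<bar> \<le> M * (3 * d / y)" if "\<bar>x / y\<bar> \<le> 2 \<or> \<bar>x' / y'\<bar> \<le> 2"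
      using that \<open>0 \<le> M\<close> by (intro mult_left_mono)
    then have cc: "\<bar>c (x / y) - c (x' / y')\<bar> \<le> M * (3 * d / y)"
      using lip [of "x / y" "x' / y'"] supp [of "x / y"] supp [of "x' / y'"] d y \<open>0 \<le> M\<close>
      by (cases "\<bar>x / y\<bar> \<le> 2 \<or> \<bar>x' / y'\<bar> \<le> 2") (fastforce simp del: abs_divide)+
    have "d / y \<le> (d / y) powr a"
      using powr_mono' [of a 1 "d / y"] a d by (simp add: divide_le_eq)
    then have dy: "y powr a * (d / y) \<le> d powr a"
      using d y by (simp add: powr_divide field_simps)
    have "\<bar>f x y - f x' y'\<bar> = \<bar>y powr a * (c (x / y) - c (x' / y')) - (y' powr a - y powr a) * c (x' / y')\<bar>"
      using y by (simp add: f_def algebra_simps)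
    also have "\<dots> \<le> y powr a * \<bar>c (x / y) - c (x' / y')\<bar> + \<bar>y' powr a - y powr a\<bar> * \<bar>c (x' / y')\<bar>"
      by (rule order_trans [OF abs_triangle_ineq4]) (simp add: abs_mult)
    also have "\<dots> \<le> y powr a * (M * (3 * d / y)) + d powr a * M"
    proof (intro add_mono mult_mono cc bd)
      have "y powr a \<le> y' powr a"
        using a y \<open>y \<le> y'\<close> by (intro powr_mono2) auto
      moreover have "(y' - y) powr a \<le> d powr a"
        using a \<open>\<bar>y - y'\<bar> \<le> d\<close> \<open>y \<le> y'\<close> by (intro powr_mono2) auto
      ultimately show "\<bar>y' powr a - y powr a\<bar> \<le> d powr a"
        using powr_diff_le [OF a y(1) \<open>y \<le> y'\<close>] by simp
    qed auto
    also have "\<dots> = 3 * M * (y powr a * (d / y)) + M * d powr a"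
      by simp
    also have "\<dots> \<le> 3 * M * d powr a + M * d powr a"
      using dy \<open>0 \<le> M\<close> by (intro add_right_mono mult_left_mono) auto
    finally show ?thesis
      by simp
  qed
  have "\<bar>f x y - f x' y'\<bar> \<le> 4 * M * d powr a" if "\<bar>x - x'\<bar> \<le> d" "\<bar>y - y'\<bar> \<le> d" for x y x' y' d
    using main [of x x' d y y'] main [of x' x d y' y] that by (cases "y \<le> y'") (auto simp: abs_minus_commute)
  then show ?thesis
    using \<open>0 \<le> M\<close> by (intro exI [of _ "4 * M"]) auto
qed

section \<open>The bump profile\<close>

text \<open>Squaring the positive part of the parabola makes the derivative Lipschitz even at the
  ends \<open>1 - \<delta>\<close> and \<open>1 + \<delta>\<close> of the support; the peak value is
  1, at \<open>t = 1\<close>.\<close>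

definition bump :: "real \<Rightarrow> real \<Rightarrow> real"
  where "bump \<delta> t = (max 0 (1 - ((t - 1) / \<delta>)\<^sup>2))\<^sup>2"

definition bump' :: "real \<Rightarrow> real \<Rightarrow> real"
  where "bump' \<delta> t = - 4 * (t - 1) / \<delta>\<^sup>2 * max 0 (1 - ((t - 1) / \<delta>)\<^sup>2)"

lemma bump_outside:
  fixes \<delta> t :: real
  assumes "0 < \<delta>" "\<delta> \<le> \<bar>t - 1\<bar>"
  shows "max 0 (1 - ((t - 1) / \<delta>)\<^sup>2) = 0"
proof -
  have "1 \<le> \<bar>(t - 1) / \<delta>\<bar>"
    using assms by (simp add: le_divide_eq)
  then have "1 \<le> ((t - 1) / \<delta>)\<^sup>2"
    by (metis one_le_power power2_abs)
  then show ?thesis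
    by linarith
qed

lemma bump_le_1: "0 \<le> bump \<delta> t" "bump \<delta> t \<le> 1"
  by (auto simp: bump_def intro!: power_le_one)

lemma DERIV_max_0_square: "((\<lambda>u::real. (max 0 u)\<^sup>2) has_real_derivative 2 * max 0 u) (at u)"
proof -
  consider "u < 0" | "u = 0" | "u > 0"
    by linarith
  then show ?thesis
  proof cases
    case 1
    have "((\<lambda>u::real. 0) has_real_derivative 0) (at u)"
      by simp
    then show ?thesis
      by (rule DERIV_cong [OF has_field_derivative_transform_within_open [where S = "{..<0}"]]) (use 1 in auto)
  next
    case 2
    have "((\<lambda>h::real. max 0 h) \<longlongrightarrow> max 0 0) (at 0)"
      by (intro tendsto_intros)
    then have "((\<lambda>h::real. max 0 h) \<longlongrightarrow> 0) (at 0)"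
      by simp
    \<comment> \<open>At the kink the difference quotient is \<open>max 0 h\<close> itself for
      \<open>h \<noteq> 0\<close>.\<close>
    then have "((\<lambda>h::real. ((max 0 (0 + h))\<^sup>2 - (max 0 0)\<^sup>2) / h) \<longlongrightarrow> 0) (at 0)"
      by (rule Lim_transform_eventually)
        (auto simp: eventually_at_filter max_def power2_eq_square)
    then show ?thesis
      using 2 by (simp add: DERIV_def)
  next
    case 3
    have "((\<lambda>u::real. u\<^sup>2) has_real_derivative 2 * u) (at u)"
      by (auto intro!: derivative_eq_intros)
    then show ?thesis
      by (rule DERIV_cong [OF has_field_derivative_transform_within_open [where S = "{0<..}"]]) (use 3 in auto)
  qed
qed

lemma DERIV_bump:
  assumes "0 < \<delta>"
  shows "(bump \<delta> has_real_derivative bump' \<delta> t) (at t)"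
proof -
  have "((\<lambda>t. 1 - ((t - 1) / \<delta>)\<^sup>2) has_real_derivative - 2 * (t - 1) / \<delta>\<^sup>2) (at t)"
    using assms by (auto intro!: derivative_eq_intros simp: power2_eq_square field_simps)
  from DERIV_chain2 [OF DERIV_max_0_square this] show ?thesis
    unfolding bump_def [abs_def] by (rule DERIV_cong) (simp add: bump'_def field_simps)
qed

text \<open>
  In terms of the truncation of \<open>(t - 1) / \<delta>\<close> to \<open>[-1, 1]\<close> the profile and its derivative
  are polynomials, and bounded Lipschitz functions form an algebra.
\<close>

lemma bounded_lipschitz_bump:
  assumes "0 < \<delta>"
  shows "bounded_lipschitz (bump \<delta>)" "bounded_lipschitz (bump' \<delta>)"
    "bounded_lipschitz (\<lambda>t. t * bump' \<delta> t)"
proof -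
  define \<tau> where "\<tau> t = max (-1) (min 1 ((t - 1) / \<delta>))" for t
  have "\<bar>\<tau> s - \<tau> t\<bar> \<le> \<bar>(s - 1) / \<delta> - (t - 1) / \<delta>\<bar>" for s t
    unfolding \<tau>_def by linarith
  also have "\<dots> s t = 1 / \<delta> * \<bar>s - t\<bar>" for s t
    using assms by (simp flip: diff_divide_distrib)
  finally have lip: "\<bar>\<tau> s - \<tau> t\<bar> \<le> 1 / \<delta> * \<bar>s - t\<bar>" for s t .
  have "\<bar>\<tau> t\<bar> \<le> 1 + 1 / \<delta> \<and> \<bar>\<tau> s - \<tau> t\<bar> \<le> (1 + 1 / \<delta>) * \<bar>s - t\<bar>" for s t
  proof -
    have "\<bar>\<tau> t\<bar> \<le> 1"
      by (auto simp: \<tau>_def)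
    moreover have "0 < 1 / \<delta>"
      using assms by simp
    moreover have "(1 + 1 / \<delta>) * \<bar>s - t\<bar> = \<bar>s - t\<bar> + 1 / \<delta> * \<bar>s - t\<bar>"
      by (simp add: distrib_right)
    ultimately show ?thesis
      using lip [of s t] by linarith
  qed
  then have \<tau>: "bounded_lipschitz \<tau>"
    unfolding bounded_lipschitz_def using assms by (intro exI [of _ "1 + 1 / \<delta>"]) auto
  note BL = bounded_lipschitz_mult bounded_lipschitz_diff bounded_lipschitz_const \<tau>
  \<comment> \<open>Outside the support \<open>\<tau> t\<close> is 1 or -1, so the factor
    \<open>1 - \<tau> t * \<tau> t\<close> removes the discrepancy between \<open>t - 1\<close> and
    \<open>\<delta> * \<tau> t\<close>.\<close>
  have m: "max 0 (1 - ((t - 1) / \<delta>)\<^sup>2) = 1 - \<tau> t * \<tau> t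
      \<and> (t - 1) * (1 - \<tau> t * \<tau> t) = \<delta> * \<tau> t * (1 - \<tau> t * \<tau> t)" for t
  proof (cases "\<bar>t - 1\<bar> < \<delta>")
    case True
    then have le: "\<bar>(t - 1) / \<delta>\<bar> \<le> 1"
      using assms by simp
    then have "\<tau> t = (t - 1) / \<delta>"
      by (simp add: \<tau>_def abs_le_iff del: abs_divide)
    moreover have "((t - 1) / \<delta>)\<^sup>2 \<le> 1"
      using le by (simp only: abs_square_le_1)
    ultimately show ?thesis
      using assms by (simp add: power2_eq_square)
  next
    case False
    then have "\<tau> t = 1 \<or> \<tau> t = -1"
      using assms by (auto simp: \<tau>_def abs_less_iff field_simps min_def max_def)
    then show ?thesis
      using bump_outside [of \<delta> t] assms False by auto
  qed
  have "bump \<delta> = (\<lambda>t. (1 - \<tau> t * \<tau> t) * (1 - \<tau> t * \<tau> t))"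
    by (simp only: bump_def fun_eq_iff m) (simp add: power2_eq_square)
  then show "bounded_lipschitz (bump \<delta>)"
    by (simp add: BL)
  have "bump' \<delta> t = - 4 / \<delta>\<^sup>2 * (\<delta> * \<tau> t * (1 - \<tau> t * \<tau> t))" for t
    unfolding bump'_def using m [of t] by (metis mult.assoc times_divide_eq_left)
  then have b': "bump' \<delta> t = - 4 / \<delta> * (\<tau> t * (1 - \<tau> t * \<tau> t))" for t
    using assms by (simp add: power2_eq_square)
  then show "bounded_lipschitz (bump' \<delta>)"
    using BL by presburger
  \<comment> \<open>The unbounded factor \<open>t\<close> is split as \<open>1 + (t - 1)\<close>,
    and \<open>t - 1\<close> is traded for \<open>\<delta> * \<tau> t\<close>.\<close>
  have "(t - 1) * bump' \<delta> t = - 4 * (\<tau> t * (\<tau> t * (1 - \<tau> t * \<tau> t)))" for t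
  proof -
    have "(t - 1) * bump' \<delta> t = - 4 / \<delta> * \<tau> t * ((t - 1) * (1 - \<tau> t * \<tau> t))"
      unfolding b' by (simp only: mult_ac)
    also have "\<dots> = - 4 / \<delta> * \<tau> t * (\<delta> * \<tau> t * (1 - \<tau> t * \<tau> t))"
      using m [of t] by presburger
    finally show ?thesis
      using assms by simp
  qed
  then have "t * bump' \<delta> t = bump' \<delta> t - 4 * (\<tau> t * (\<tau> t * (1 - \<tau> t * \<tau> t)))" for t
    by (simp add: algebra_simps)
  then show "bounded_lipschitz (\<lambda>t. t * bump' \<delta> t)"
    using BL \<open>bounded_lipschitz (bump' \<delta>)\<close> by presburger
qed

section \<open>The perturbation and its derivative\<close>

definition kick :: "real \<Rightarrow> real \<Rightarrow> real \<Rightarrow> real \<Rightarrow> real"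
  where "kick \<alpha> \<delta> x y = (if 0 < y then y powr (1 + \<alpha>) * bump \<delta> (x / y) else 0)"

definition kick_dx :: "real \<Rightarrow> real \<Rightarrow> real \<Rightarrow> real \<Rightarrow> real"
  where "kick_dx \<alpha> \<delta> x y = (if 0 < y then y powr \<alpha> * bump' \<delta> (x / y) else 0)"

text \<open>The inner derivative \<open>- x / y\<^sup>2\<close> is distributed over the powers of
  \<open>y\<close> so that the bracket depends on \<open>x / y\<close> alone, as
  \<open>holder_homogeneous\<close> requires.\<close>

definition kick_dy :: "real \<Rightarrow> real \<Rightarrow> real \<Rightarrow> real \<Rightarrow> real"
  where "kick_dy \<alpha> \<delta> x y =
    (if 0 < y then y powr \<alpha> * ((1 + \<alpha>) * bump \<delta> (x / y) - x / y * bump' \<delta> (x / y)) else 0)"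

lemma kick_diag: "0 < s \<Longrightarrow> kick \<alpha> \<delta> s s = s * s powr \<alpha>"
  by (simp add: kick_def bump_def powr_add)

text \<open>The support condition is multiplied out, so that it can be tested on the axes and for
  coordinates of either sign.\<close>

lemma kick_eq_0:
  assumes "0 < \<delta>" "\<delta> * \<bar>y\<bar> \<le> \<bar>x - y\<bar>"
  shows "kick \<alpha> \<delta> x y = 0"
proof (cases "0 < y")
  case True
  then have "x / y - 1 = (x - y) / y"
    by (simp add: field_simps)
  then have "\<bar>x / y - 1\<bar> = \<bar>x - y\<bar> / y"
    using True by (simp add: abs_divide)
  then have "\<delta> \<le> \<bar>x / y - 1\<bar>"
    using assms True by (simp add: le_divide_eq)
  then show ?thesis
    using bump_outside [OF assms(1), of "x / y"] by (simp add: kick_def bump_def)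
qed (simp add: kick_def)

lemma kick_holder:
  assumes "0 < \<alpha>" "\<alpha> \<le> 1" "0 < \<delta>" "\<delta> < 1"
  obtains C where "0 \<le> C"
    "\<And>x y x' y' d. \<bar>x - x'\<bar> \<le> d \<Longrightarrow> \<bar>y - y'\<bar> \<le> d
      \<Longrightarrow> \<bar>kick_dx \<alpha> \<delta> x y - kick_dx \<alpha> \<delta> x' y'\<bar> \<le> C * d powr \<alpha>
        \<and> \<bar>kick_dy \<alpha> \<delta> x y - kick_dy \<alpha> \<delta> x' y'\<bar> \<le> C * d powr \<alpha>"
proof -
  have supp: "bump \<delta> t = 0" "bump' \<delta> t = 0" if "2 \<le> \<bar>t\<bar>" for t
  proof -
    have "\<delta> \<le> \<bar>t - 1\<bar>"
      using that assms by linarith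
    then show "bump \<delta> t = 0" "bump' \<delta> t = 0"
      using bump_outside [of \<delta> t] assms by (simp_all add: bump_def bump'_def)
  qed
  obtain C where C: "0 \<le> C" "\<And>x y x' y' d. \<bar>x - x'\<bar> \<le> d \<Longrightarrow> \<bar>y - y'\<bar> \<le> d
      \<Longrightarrow> \<bar>kick_dx \<alpha> \<delta> x y - kick_dx \<alpha> \<delta> x' y'\<bar> \<le> C * d powr \<alpha>"
    using holder_homogeneous [OF assms(1,2) bounded_lipschitz_bump(2) [OF assms(3)] supp(2)]
    unfolding kick_dx_def by metis
  have "bounded_lipschitz (\<lambda>t. (1 + \<alpha>) * bump \<delta> t - t * bump' \<delta> t)"
    by (intro bounded_lipschitz_diff bounded_lipschitz_mult bounded_lipschitz_const
        bounded_lipschitz_bump assms)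
  from holder_homogeneous [OF assms(1,2) this]
  obtain D where D: "0 \<le> D" "\<And>x y x' y' d. \<bar>x - x'\<bar> \<le> d \<Longrightarrow> \<bar>y - y'\<bar> \<le> d
      \<Longrightarrow> \<bar>kick_dy \<alpha> \<delta> x y - kick_dy \<alpha> \<delta> x' y'\<bar> \<le> D * d powr \<alpha>"
    unfolding kick_dy_def by (metis diff_zero mult_zero_right supp)
  have "C * d powr \<alpha> \<le> max C D * d powr \<alpha>" "D * d powr \<alpha> \<le> max C D * d powr \<alpha>" for d
    by (auto intro!: mult_right_mono)
  then show ?thesis
    using C D by (intro that [of "max C D"] conjI) (auto intro!: order_trans [OF C(2)] order_trans [OF D(2)])
qed

text \<open>\<open>X\<close> and \<open>Y\<close> stand for the two coordinate functionals. At
  points with \<open>Y v \<le> 0\<close> the derivative is 0 because the exponent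
  \<open>1 + \<alpha>\<close> exceeds 1.\<close>

lemma has_derivative_kick:
  fixes X Y :: "'a::real_normed_vector \<Rightarrow> real"
  assumes "0 < \<alpha>" "0 < \<delta>" and X: "bounded_linear X" and Y: "bounded_linear Y"
  shows "((\<lambda>v. kick \<alpha> \<delta> (X v) (Y v)) has_derivative
    (\<lambda>h. kick_dx \<alpha> \<delta> (X v) (Y v) * X h + kick_dy \<alpha> \<delta> (X v) (Y v) * Y h)) (at v)"
proof (cases "0 < Y v")
  case True
  note dX = bounded_linear_imp_has_derivative [OF X]
  note dY = bounded_linear_imp_has_derivative [OF Y]
  have dP: "((\<lambda>v. Y v powr (1 + \<alpha>)) has_derivative (\<lambda>h. Y h * ((1 + \<alpha>) * Y v powr \<alpha>))) (at v)"
    using DERIV_compose_FDERIV [OF has_real_derivative_powr [OF True, of "1 + \<alpha>"] dY] by simp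
  have dQ: "((\<lambda>v. X v / Y v) has_derivative (\<lambda>h. (X h * Y v - X v * Y h) / (Y v * Y v))) (at v)"
    using True by (intro has_derivative_divide' dX dY) simp
  note dB = DERIV_compose_FDERIV [OF DERIV_bump [OF \<open>0 < \<delta>\<close>] dQ]
  have "((\<lambda>v. Y v powr (1 + \<alpha>) * bump \<delta> (X v / Y v)) has_derivative
    (\<lambda>h. kick_dx \<alpha> \<delta> (X v) (Y v) * X h + kick_dy \<alpha> \<delta> (X v) (Y v) * Y h)) (at v)"
  proof (rule has_derivative_eq_rhs [OF has_derivative_mult [OF dP dB]], rule ext)
    fix h
    have "Y v powr (1 + \<alpha>) = Y v powr \<alpha> * Y v"
      using True by (simp add: powr_add)
    then show "Y v powr (1 + \<alpha>) * ((X h * Y v - X v * Y h) / (Y v * Y v) * bump' \<delta> (X v / Y v))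
        + Y h * ((1 + \<alpha>) * Y v powr \<alpha>) * bump \<delta> (X v / Y v)
      = kick_dx \<alpha> \<delta> (X v) (Y v) * X h + kick_dy \<alpha> \<delta> (X v) (Y v) * Y h"
      using True by (simp add: kick_dx_def kick_dy_def field_simps)
  qed
  then show ?thesis
  proof (rule has_derivative_transform_within_open)
    show "open {v. 0 < Y v}"
      using bounded_linear.continuous_on [OF Y continuous_on_id]
      by (intro open_Collect_less continuous_intros) auto
  qed (use True in \<open>auto simp: kick_def\<close>)
next
  case False
  obtain K where K: "0 < K" "\<And>h. \<bar>Y h\<bar> \<le> K * norm h"
    using bounded_linear.pos_bounded [OF Y] by (auto simp: mult.commute)
  \<comment> \<open>As \<open>Y v \<le> 0\<close>, a positive \<open>Y w\<close> is at most
    \<open>Y (w - v)\<close>, hence of the order of the distance.\<close>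
  have small: "\<bar>kick \<alpha> \<delta> (X w) (Y w)\<bar> \<le> (K * norm (w - v)) powr (1 + \<alpha>)" for w
  proof (cases "0 < Y w")
    case True
    have "Y w \<le> Y (w - v)"
      using False Y by (simp add: linear_diff bounded_linear.linear)
    then have "Y w \<le> K * norm (w - v)"
      using K(2) [of "w - v"] by linarith
    then have "Y w powr (1 + \<alpha>) \<le> (K * norm (w - v)) powr (1 + \<alpha>)"
      using True \<open>0 < \<alpha>\<close> by (intro powr_mono2) auto
    moreover have "\<bar>kick \<alpha> \<delta> (X w) (Y w)\<bar> \<le> Y w powr (1 + \<alpha>)"
      using True bump_le_1 by (simp add: kick_def abs_mult mult_left_le)
    ultimately show ?thesis
      by linarith
  qed (simp add: kick_def)
  have "((\<lambda>w. kick \<alpha> \<delta> (X w) (Y w)) has_derivative (\<lambda>h. 0)) (at v)"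
    unfolding has_derivative_at_within
  proof (intro conjI bounded_linear_zero)
    have lim: "((\<lambda>w. K powr (1 + \<alpha>) * norm (w - v) powr \<alpha>) \<longlongrightarrow> 0) (at v)"
    proof -
      have "((\<lambda>w. norm (w - v)) \<longlongrightarrow> norm (v - v)) (at v)"
        by (intro tendsto_intros)
      then have "((\<lambda>w. norm (w - v) powr \<alpha>) \<longlongrightarrow> 0) (at v)"
        using tendsto_powr2 [OF _ tendsto_const, of _ 0 _ \<alpha>] \<open>0 < \<alpha>\<close> by fastforce
      then show ?thesis
        by (rule tendsto_mult_right_zero)
    qed
    have "norm ((kick \<alpha> \<delta> (X w) (Y w) - kick \<alpha> \<delta> (X v) (Y v) - 0) /\<^sub>R norm (w - v))
        \<le> K powr (1 + \<alpha>) * norm (w - v) powr \<alpha>" if "w \<noteq> v" for w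
      using small [of w] that K(1) False
      by (simp add: kick_def [of _ _ "X v"] powr_mult powr_add divide_inverse_commute [symmetric]
          divide_le_eq mult_ac)
    then show "((\<lambda>w. (kick \<alpha> \<delta> (X w) (Y w) - kick \<alpha> \<delta> (X v) (Y v) - 0) /\<^sub>R norm (w - v)) \<longlongrightarrow> 0) (at v)"
      by (intro Lim_null_comparison [OF _ lim]) (simp add: eventually_at_filter)
  qed
  then show ?thesis
    using False by (simp add: kick_dx_def kick_dy_def)
qed

section \<open>Scaling equations and orbit gaps\<close>

text \<open>Iterating the equation drives the argument \<open>\<mu> ^ n * y\<close> to 0, where
  continuity applies.\<close>

lemma iterate_scaling:
  fixes h :: "real \<Rightarrow> real"
  assumes "\<bar>\<mu>\<bar> < 1" and h: "\<And>y. \<bar>y\<bar> < r \<Longrightarrow> h (\<mu> * y) = \<nu> * h y" and "isCont h 0" and y: "\<bar>y\<bar> < r"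
  shows "(\<lambda>n. \<nu> ^ n * h y) \<longlonglongrightarrow> h 0"
proof -
  have eq: "h (\<mu> ^ n * y) = \<nu> ^ n * h y" for n
  proof (induction n)
    case (Suc n)
    have "\<bar>\<mu> ^ n * y\<bar> \<le> \<bar>y\<bar>"
      using assms(1) by (simp add: abs_mult power_abs mult_left_le_one_le power_le_one)
    then show ?case
      using h [of "\<mu> ^ n * y"] y Suc by (simp add: mult.assoc)
  qed simp
  have "(\<lambda>n. \<mu> ^ n * y) \<longlonglongrightarrow> 0 * y"
    by (intro tendsto_mult LIMSEQ_power_zero tendsto_const) (use assms(1) in simp)
  then have "(\<lambda>n. h (\<mu> ^ n * y)) \<longlonglongrightarrow> h 0"
    using isCont_tendsto_compose [OF \<open>isCont h 0\<close>] by fastforce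
  then show ?thesis
    by (simp add: eq)
qed

text \<open>A contraction is iterated and an expansion is replaced by its inverse. The equation is
  assumed only while both points stay within radius \<open>r\<close>, as a local conjugacy provides
  it.\<close>

lemma scaling_const:
  fixes h :: "real \<Rightarrow> real"
  assumes "\<mu> \<noteq> 0" "\<bar>\<mu>\<bar> \<noteq> 1" and h: "\<And>y. \<bar>y\<bar> < r \<Longrightarrow> \<bar>\<mu> * y\<bar> < r \<Longrightarrow> h (\<mu> * y) = h y"
    and "isCont h 0" and y: "\<bar>y\<bar> < r"
  shows "h y = h 0"
proof -
  have *: "h y = h 0" if "\<bar>m\<bar> < 1" "\<And>y. \<bar>y\<bar> < r \<Longrightarrow> h (m * y) = h y" for m
    using iterate_scaling [of m r h 1 y] that \<open>isCont h 0\<close> y by (simp add: LIMSEQ_const_iff)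
  show ?thesis
  proof (cases "\<bar>\<mu>\<bar> < 1")
    case True
    have "\<bar>\<mu> * y\<bar> < r" if "\<bar>y\<bar> < r" for y
      using that True mult_left_le_one_le [of "\<bar>y\<bar>" "\<bar>\<mu>\<bar>"] by (simp add: abs_mult)
    then show ?thesis
      using * [of \<mu>] True h by blast
  next
    case False
    then have "1 < \<bar>\<mu>\<bar>"
      using assms(2) by simp
    have "h (1 / \<mu> * y) = h y" if "\<bar>y\<bar> < r" for y
    proof -
      have "\<bar>y\<bar> / \<bar>\<mu>\<bar> \<le> \<bar>y\<bar>"
        using \<open>1 < \<bar>\<mu>\<bar>\<close> divide_left_mono [of 1 "\<bar>\<mu>\<bar>" "\<bar>y\<bar>"] by simp
      then show ?thesis
        using h [of "y / \<mu>"] that \<open>\<mu> \<noteq> 0\<close> by simp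
    qed
    then show ?thesis
      using * [of "1 / \<mu>"] \<open>1 < \<bar>\<mu>\<bar>\<close> by simp
  qed
qed

text \<open>If \<open>\<mu>\<close> contracts and \<open>\<nu>\<close> expands, the sequence
  \<open>\<nu> ^ n * h y\<close> can converge only for \<open>h y = 0\<close>; inverting both
  factors reduces the other case to this one.\<close>

lemma scaling_eq_0:
  fixes h :: "real \<Rightarrow> real"
  assumes "\<mu> \<noteq> 0" "\<nu> \<noteq> 0" and or: "\<bar>\<mu>\<bar> < 1 \<and> 1 < \<bar>\<nu>\<bar> \<or> \<bar>\<nu>\<bar> < 1 \<and> 1 < \<bar>\<mu>\<bar>"
    and h: "\<And>y. \<bar>y\<bar> < r \<Longrightarrow> \<bar>\<mu> * y\<bar> < r \<Longrightarrow> h (\<mu> * y) = \<nu> * h y"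
    and "isCont h 0" and y: "\<bar>y\<bar> < r"
  shows "h y = 0"
proof -
  have *: "h y = 0" if "\<bar>m\<bar> < 1" "1 < \<bar>n\<bar>" "\<And>y. \<bar>y\<bar> < r \<Longrightarrow> h (m * y) = n * h y" for m n
  proof -
    have "(\<lambda>k. (1 / n) ^ k * (n ^ k * h y)) \<longlonglongrightarrow> 0 * h 0"
      by (intro tendsto_mult LIMSEQ_power_zero iterate_scaling [of m r])
        (use that \<open>isCont h 0\<close> y in auto)
    moreover have "(1 / n) ^ k * (n ^ k * h y) = h y" for k
      using that(2) by (auto simp: power_divide)
    ultimately show ?thesis
      by (simp add: LIMSEQ_const_iff)
  qed
  show ?thesis
    using or
  proof
    assume \<mu>: "\<bar>\<mu>\<bar> < 1 \<and> 1 < \<bar>\<nu>\<bar>"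
    have "\<bar>\<mu> * y\<bar> < r" if "\<bar>y\<bar> < r" for y
      using that \<mu> mult_left_le_one_le [of "\<bar>y\<bar>" "\<bar>\<mu>\<bar>"] by (simp add: abs_mult)
    then show ?thesis
      using * [of \<mu> \<nu>] \<mu> h by blast
  next
    assume \<mu>: "\<bar>\<nu>\<bar> < 1 \<and> 1 < \<bar>\<mu>\<bar>"
    have "h (1 / \<mu> * y) = 1 / \<nu> * h y" if "\<bar>y\<bar> < r" for y
    proof -
      have "\<bar>y\<bar> / \<bar>\<mu>\<bar> \<le> \<bar>y\<bar>"
        using \<mu> \<open>\<mu> \<noteq> 0\<close> divide_left_mono [of 1 "\<bar>\<mu>\<bar>" "\<bar>y\<bar>"] by simp
      then have "h y = \<nu> * h (y / \<mu>)"
        using h [of "y / \<mu>"] that \<open>\<mu> \<noteq> 0\<close> by simp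
      then show ?thesis
        using \<open>\<nu> \<noteq> 0\<close> by simp
    qed
    then show ?thesis
      using * [of "1 / \<mu>" "1 / \<nu>"] \<mu> \<open>\<mu> \<noteq> 0\<close> \<open>\<nu> \<noteq> 0\<close> by simp
  qed
qed

text \<open>\<open>\<kappa>\<close> is meant as \<open>\<bar>lq / lp\<bar>\<close>. Along the orbit
  of a diagonal point the moduli of the coordinates have ratio \<open>\<kappa> ^ i\<close> in the
  past and \<open>\<theta> / \<kappa> ^ i\<close> in the future, \<open>\<theta>\<close> being the
  factor gained at the cone. The bound \<open>\<eta>\<close> prevents \<open>\<theta>\<close> from
  undoing a step.\<close>

lemma gap_exists:
  fixes \<kappa> :: real
  assumes "0 < \<kappa>" "\<kappa> \<noteq> 1"
  obtains \<delta> \<eta> where "0 < \<delta>" "\<delta> < 1" "0 < \<eta>"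
    "\<And>i. 1 \<le> i \<Longrightarrow> \<delta> \<le> \<bar>\<kappa> ^ i - 1\<bar>"
    "\<And>i \<theta>. 1 \<le> i \<Longrightarrow> 1 \<le> \<theta> \<Longrightarrow> \<theta> \<le> 1 + \<eta> \<Longrightarrow> \<delta> \<le> \<bar>\<theta> / \<kappa> ^ i - 1\<bar>"
proof (cases "1 < \<kappa>")
  case True
  have ge: "\<kappa> \<le> \<kappa> ^ i" if "1 \<le> i" for i
    using power_increasing [of 1 i \<kappa>] that True by simp
  show ?thesis
  \<comment> \<open>\<open>1 + \<eta>\<close> is the midpoint of 1 and \<open>\<kappa>\<close>, and
    \<open>\<delta>\<close> is the gap \<open>1 - (1 + \<eta>) / \<kappa>\<close>.\<close>
  proof (rule that [of "(\<kappa> - 1) / (2 * \<kappa>)" "(\<kappa> - 1) / 2"])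
    have "\<kappa> - 1 \<le> (\<kappa> - 1) * (2 * \<kappa>)"
      using True by simp
    then have "(\<kappa> - 1) / (2 * \<kappa>) \<le> \<kappa> - 1"
      using True by (simp add: divide_le_eq)
    then show "(\<kappa> - 1) / (2 * \<kappa>) \<le> \<bar>\<kappa> ^ i - 1\<bar>" if "1 \<le> i" for i
      using ge [OF that] True by linarith
    show "(\<kappa> - 1) / (2 * \<kappa>) \<le> \<bar>\<theta> / \<kappa> ^ i - 1\<bar>"
      if "1 \<le> i" "1 \<le> \<theta>" "\<theta> \<le> 1 + (\<kappa> - 1) / 2" for i \<theta>
    proof -
      have "\<theta> / \<kappa> ^ i \<le> (1 + (\<kappa> - 1) / 2) / \<kappa>"
        using that ge [OF that(1)] True by (intro frac_le) auto
      also have "\<dots> = 1 - (\<kappa> - 1) / (2 * \<kappa>)"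
        using True by (simp add: field_simps)
      finally show ?thesis
        by linarith
    qed
  qed (use True in \<open>auto simp: field_simps\<close>)
next
  case False
  then have \<kappa>: "\<kappa> < 1"
    using assms by simp
  have le: "\<kappa> ^ i \<le> \<kappa>" if "1 \<le> i" for i
    using power_decreasing [of 1 i \<kappa>] that assms \<kappa> by simp
  show ?thesis
  proof (rule that [of "1 - \<kappa>" 1])
    show "1 - \<kappa> \<le> \<bar>\<kappa> ^ i - 1\<bar>" if "1 \<le> i" for i
      using le [OF that] by linarith
    show "1 - \<kappa> \<le> \<bar>\<theta> / \<kappa> ^ i - 1\<bar>" if "1 \<le> i" "1 \<le> \<theta>" for i \<theta>
    proof -
      have "1 / \<kappa> \<le> \<theta> / \<kappa> ^ i"
        using that le [OF that(1)] assms by (intro frac_le) auto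
      \<comment> \<open>This is \<open>(1 - \<kappa>)\<^sup>2 \<ge> 0\<close> divided by
        \<open>\<kappa>\<close>.\<close>
      moreover have "2 - \<kappa> \<le> 1 / \<kappa>"
        using assms sum_squares_ge_zero [of "1 - \<kappa>" 0] by (simp add: le_divide_eq algebra_simps)
      ultimately show ?thesis
        by linarith
    qed
  qed (use assms \<kappa> in auto)
qed

text \<open>With \<open>K\<close> close to \<open>q * N / p\<close>, the largest value allowed, the
  \<open>D\<close> term decays faster than the left side because \<open>\<alpha> \<le> 1\<close>. So
  the \<open>C\<close> term must not decay faster, which compares \<open>(p + q) * \<beta>\<close>
  with \<open>\<alpha> * q\<close>.\<close>

lemma exponential_rate_bound:
  fixes p q \<alpha> \<beta> c C D :: real
  assumes pq: "0 < p" "0 < q" and "\<alpha> \<le> 1" and "0 < c"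
    and ineq: "\<And>N K. N\<^sub>0 \<le> N \<Longrightarrow> 1 \<le> K \<Longrightarrow> p * real K \<le> q * real N \<Longrightarrow>
      c * exp (- \<alpha> * q * N) \<le> C * exp (- (p + q) * \<beta> * N) + D * exp (- (p + q) * K)"
  shows "\<beta> \<le> \<alpha> * q / (p + q)"
proof (rule ccontr)
  assume "\<not> ?thesis"
  then have \<epsilon>: "(p + q) * \<beta> - \<alpha> * q > 0"
    using pq by (simp add: divide_less_eq mult.commute not_le)
  define \<epsilon> where "\<epsilon> = (p + q) * \<beta> - \<alpha> * q"
  \<comment> \<open>The surplus decay rate of the \<open>D\<close> term, equal to
    \<open>q * (1 - \<alpha>) + q * q / p\<close>.\<close>
  define \<zeta> where "\<zeta> = (p + q) * (q / p) - \<alpha> * q"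
  have "\<alpha> * q \<le> 1 * q"
    using pq assms(3) by (intro mult_right_mono) auto
  moreover have "(p + q) * (q / p) = q + q * q / p"
    using pq by (simp add: field_simps)
  moreover have "0 < q * q / p"
    using pq by simp
  ultimately have "0 < \<zeta>"
    by (simp add: \<zeta>_def)
  have exp_lim: "(\<lambda>N. exp (- e * real N)) \<longlonglongrightarrow> 0" if "0 < e" for e
  proof -
    have "(\<lambda>N. exp (- e) ^ N) \<longlonglongrightarrow> 0"
      using that by (intro LIMSEQ_power_zero) simp
    then show ?thesis
      by (simp add: exp_of_nat_mult [symmetric] mult.commute)
  qed
  have "(\<lambda>N. C * exp (- \<epsilon> * real N) + \<bar>D\<bar> * exp (p + q) * exp (- \<zeta> * real N))
      \<longlonglongrightarrow> C * 0 + \<bar>D\<bar> * exp (p + q) * 0"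
    using \<epsilon> \<open>0 < \<zeta>\<close> by (intro tendsto_intros exp_lim) (auto simp: \<epsilon>_def)
  moreover have "\<forall>\<^sub>F N in sequentially.
      c \<le> C * exp (- \<epsilon> * real N) + \<bar>D\<bar> * exp (p + q) * exp (- \<zeta> * real N)"
    unfolding eventually_sequentially
  proof (intro exI allI impI)
    fix N :: nat assume N: "max N\<^sub>0 (nat \<lceil>p / q\<rceil>) \<le> N"
    define K where "K = nat \<lfloor>q * N / p\<rfloor>"
    have "p / q \<le> real N"
      using N by linarith
    then have "1 \<le> q * N / p"
      using pq by (simp add: field_simps)
    then have K: "1 \<le> K" "real K \<le> q * N / p" "q * N / p - 1 \<le> real K"
      by (auto simp: K_def le_nat_iff le_floor_iff; linarith)+
    have "p * real K \<le> q * real N"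
      using K(2) pq by (simp add: field_simps)
    then have "c * exp (- \<alpha> * q * N) \<le> C * exp (- (p + q) * \<beta> * N) + D * exp (- (p + q) * K)"
      using ineq N K(1) by simp
    \<comment> \<open>Rounding \<open>K\<close> down loses at most 1, which costs the constant
      factor \<open>exp (p + q)\<close>.\<close>
    also have "\<dots> \<le> C * exp (- (p + q) * \<beta> * N) + \<bar>D\<bar> * exp (- (p + q) * (q * N / p - 1))"
    proof (intro add_left_mono mult_mono)
      have "(p + q) * (q * N / p - 1) \<le> (p + q) * K"
        using K(3) pq by (intro mult_left_mono) auto
      then show "exp (- (p + q) * K) \<le> exp (- (p + q) * (q * N / p - 1))"
        unfolding exp_le_cancel_iff mult_minus_left by linarith
    qed auto
    finally have "c * exp (- \<alpha> * q * N) * exp (\<alpha> * q * N)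
        \<le> (C * exp (- (p + q) * \<beta> * N) + \<bar>D\<bar> * exp (- (p + q) * (q * N / p - 1))) * exp (\<alpha> * q * N)"
      by (intro mult_right_mono) auto
    also have "c * exp (- \<alpha> * q * N) * exp (\<alpha> * q * N) = c"
      by (simp add: mult.assoc flip: exp_add)
    also have "(C * exp (- (p + q) * \<beta> * N) + \<bar>D\<bar> * exp (- (p + q) * (q * N / p - 1))) * exp (\<alpha> * q * N)
      = C * exp (- (p + q) * \<beta> * N + \<alpha> * q * N)
        + \<bar>D\<bar> * exp (- (p + q) * (q * N / p - 1) + \<alpha> * q * N)"
      by (simp add: distrib_right mult.assoc exp_add)
    also have "- (p + q) * \<beta> * N + \<alpha> * q * N = - \<epsilon> * N"
      by (simp add: \<epsilon>_def algebra_simps)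
    also have "- (p + q) * (q * N / p - 1) + \<alpha> * q * N = (p + q) + - \<zeta> * N"
      using pq by (simp add: \<zeta>_def field_simps)
    finally show "c \<le> C * exp (- \<epsilon> * real N) + \<bar>D\<bar> * exp (p + q) * exp (- \<zeta> * real N)"
      by (simp only: exp_add [of "p + q"] mult.assoc)
  qed
  ultimately have "c \<le> C * 0 + \<bar>D\<bar> * exp (p + q) * 0"
    by (intro tendsto_lowerbound) auto
  then show False
    using \<open>0 < c\<close> by simp
qed

section \<open>The bound on the exponent along one orbit\<close>

text \<open>
  Below \<open>f x y\<close> stands for the \<open>p\<close>-component of a linearization at the point with coordinates
  \<open>x\<close>, \<open>y\<close> along the \<open>p\<close>- and \<open>q\<close>-axes, and \<open>fx\<close> for its derivative along the \<open>p\<close>-axis.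
  The gap conditions say that the orbit of a diagonal point \<open>(s, s)\<close> avoids, at all other times,
  the cone in which the perturbation lives.
\<close>

context
  fixes f fx :: "real \<Rightarrow> real \<Rightarrow> real" and lp lq \<alpha> \<beta> \<delta> \<eta> r C a :: real
  assumes \<alpha>: "0 < \<alpha>" "\<alpha> \<le> 1" and \<beta>: "0 < \<beta>" "\<beta> \<le> 1" and \<delta>: "0 < \<delta>" "\<delta> < 1" and "0 < \<eta>"
    and r: "0 < r" "r \<le> 1" and C: "0 \<le> C"
    and l: "lp \<noteq> 0" "lq \<noteq> 0" and hyp: "\<bar>lp\<bar> < 1 \<and> 1 < \<bar>lq\<bar> \<or> \<bar>lq\<bar> < 1 \<and> 1 < \<bar>lp\<bar>"
    and gap1: "\<And>i. 1 \<le> i \<Longrightarrow> \<delta> \<le> \<bar>\<bar>lq / lp\<bar> ^ i - 1\<bar>"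
    and gap2: "\<And>i \<theta>. 1 \<le> i \<Longrightarrow> 1 \<le> \<theta> \<Longrightarrow> \<theta> \<le> 1 + \<eta> \<Longrightarrow> \<delta> \<le> \<bar>\<theta> / \<bar>lq / lp\<bar> ^ i - 1\<bar>"
    and dx: "\<And>x y. \<bar>x\<bar> < r \<Longrightarrow> \<bar>y\<bar> < r \<Longrightarrow> ((\<lambda>x. f x y) has_real_derivative fx x y) (at x)"
    and lip: "\<And>x y. \<bar>x\<bar> < r \<Longrightarrow> \<bar>y\<bar> < r \<Longrightarrow> \<bar>f x y - f x 0\<bar> \<le> C * \<bar>y\<bar>"
    and holder: "\<And>x y. \<bar>x\<bar> < r \<Longrightarrow> \<bar>y\<bar> < r \<Longrightarrow> \<bar>fx x y - fx 0 y\<bar> \<le> C * \<bar>x\<bar> powr \<beta>"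
    and cont_fx: "isCont (fx 0) 0"
    and conj: "\<And>x y. \<bar>x\<bar> < r \<Longrightarrow> \<bar>y\<bar> < r \<Longrightarrow> \<bar>lp * (x + kick \<alpha> \<delta> x y)\<bar> < r \<Longrightarrow> \<bar>lq * y\<bar> < r
      \<Longrightarrow> f (lp * (x + kick \<alpha> \<delta> x y)) (lq * y) = lp * f x y"
    and a_def: "a = fx 0 0"
begin

section \<open>The linearization on and near the axes\<close>

text \<open>The axis \<open>x = 0\<close> avoids the cone, so \<open>f 0\<close> obeys a scaling
  equation with one contracting and one expanding factor.\<close>

lemma f_0_left:
  assumes "\<bar>y\<bar> < r"
  shows "f 0 y = 0"
proof (rule scaling_eq_0 [OF l(2,1), where r = r and h = "\<lambda>y. f 0 y"])
  show "\<bar>lq\<bar> < 1 \<and> 1 < \<bar>lp\<bar> \<or> \<bar>lp\<bar> < 1 \<and> 1 < \<bar>lq\<bar>"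
    using hyp by blast
  show "f 0 (lq * y) = lp * f 0 y" if "\<bar>y\<bar> < r" "\<bar>lq * y\<bar> < r" for y
  proof -
    have "kick \<alpha> \<delta> 0 y = 0"
      using \<delta> by (intro kick_eq_0) (auto intro: mult_left_le_one_le)
    then show ?thesis
      using conj [of 0 y] that r by simp
  qed
  have "((\<lambda>y. f 0 y) \<longlongrightarrow> f 0 0) (at 0)"
  proof (rule Lim_null_comparison [where g = "\<lambda>y. C * \<bar>y\<bar>", THEN Lim_null [THEN iffD2]])
    have "\<forall>\<^sub>F y in at 0. y \<in> {-r<..<r}"
      using r by (intro eventually_at_in_open') auto
    then show "\<forall>\<^sub>F y in at 0. norm (f 0 y - f 0 0) \<le> C * \<bar>y\<bar>"
      by eventually_elim (use lip [of 0] r in auto)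
    have "((\<lambda>y. C * \<bar>y\<bar>) \<longlongrightarrow> C * \<bar>0\<bar>) (at (0::real))"
      by (intro tendsto_intros)
    then show "((\<lambda>y. C * \<bar>y\<bar>) \<longlongrightarrow> 0) (at (0::real))"
      by simp
  qed
  then show "isCont (\<lambda>y. f 0 y) 0"
    by (simp add: isCont_def)
qed (use assms in auto)

text \<open>Differentiating the conjugacy in \<open>x\<close> at \<open>(0, y)\<close> cancels
  \<open>lp\<close> and leaves \<open>fx 0\<close> invariant under multiplication by
  \<open>lq\<close>.\<close>

lemma fx_0_left:
  assumes "\<bar>y\<bar> < r"
  shows "fx 0 y = a"
  unfolding a_def
proof (rule scaling_const [OF l(2), where r = r and h = "fx 0"])
  show "\<bar>lq\<bar> \<noteq> 1"
    using hyp by auto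
  show "fx 0 (lq * y) = fx 0 y" if y: "\<bar>y\<bar> < r" "\<bar>lq * y\<bar> < r" for y
  proof (cases "y = 0")
    case False
    \<comment> \<open>This keeps \<open>x\<close> and \<open>lp * x\<close> inside the domain and
      \<open>(x, y)\<close> outside the cone.\<close>
    define e where "e = min (min r (r / \<bar>lp\<bar>)) ((1 - \<delta>) * \<bar>y\<bar>)"
    have "0 < e"
      using r l \<delta> False by (simp add: e_def)
    have eq: "f (lp * x) (lq * y) = lp * f x y" if x: "x \<in> {-e<..<e}" for x
    proof -
      have x': "\<bar>x\<bar> < r" "\<bar>x\<bar> < r / \<bar>lp\<bar>" "\<bar>x\<bar> < (1 - \<delta>) * \<bar>y\<bar>"
        using x by (auto simp: e_def abs_less_iff)
      have "\<delta> * \<bar>y\<bar> \<le> \<bar>x - y\<bar>"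
        using x'(3) by (simp add: algebra_simps)
      then have "kick \<alpha> \<delta> x y = 0"
        using \<delta> by (intro kick_eq_0)
      moreover have "\<bar>lp * x\<bar> < r"
        using x'(2) l by (simp add: abs_mult less_divide_eq mult.commute)
      ultimately show ?thesis
        using conj [of x y] x'(1) y by simp
    qed
    have "((\<lambda>x. f (lp * x) (lq * y)) has_real_derivative fx (lp * 0) (lq * y) * lp) (at 0)"
      using dx [of "lp * 0" "lq * y"] y r
      by (intro DERIV_chain2 [where f = "\<lambda>x. f x (lq * y)"]) (auto intro!: derivative_eq_intros)
    moreover have "((\<lambda>x. f (lp * x) (lq * y)) has_real_derivative lp * fx 0 y) (at 0)"
    proof (rule has_field_derivative_transform_within_open)
      show "((\<lambda>x. lp * f x y) has_real_derivative lp * fx 0 y) (at 0)"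
        by (intro DERIV_cmult dx) (use r y in auto)
      show "lp * f x y = f (lp * x) (lq * y)" if "x \<in> {-e<..<e}" for x
        by (rule eq [OF that, symmetric])
    qed (use \<open>0 < e\<close> in auto)
    ultimately have "fx (lp * 0) (lq * y) * lp = lp * fx 0 y"
      by (rule DERIV_unique)
    then show ?thesis
      using l by simp
  qed simp
qed (use cont_fx assms in auto)

text \<open>The quotient \<open>f x 0 / x\<close>, completed by the derivative \<open>a\<close> at
  0, is continuous there and invariant under \<open>lp\<close>.\<close>

lemma f_0_right:
  assumes "\<bar>x\<bar> < r"
  shows "f x 0 = a * x"
proof -
  define h where "h x = (if x = 0 then a else f x 0 / x)" for x
  have f00: "f 0 0 = 0"
    using f_0_left r by simp
  have "h x = h 0"
  proof (rule scaling_const [OF l(1), where r = r and h = h])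
    show "\<bar>lp\<bar> \<noteq> 1"
      using hyp by auto
    show "h (lp * x) = h x" if "\<bar>x\<bar> < r" "\<bar>lp * x\<bar> < r" for x
      using conj [of x 0] that r l by (simp add: h_def kick_def)
    have "((\<lambda>x. f x 0 / x) \<longlongrightarrow> a) (at 0)"
      using dx [of 0 0] r by (simp add: DERIV_def a_def f00)
    then have "(h \<longlongrightarrow> a) (at 0)"
      by (rule Lim_transform_eventually) (simp add: eventually_at_filter h_def)
    then show "isCont h 0"
      by (simp add: isCont_def h_def)
  qed (use assms in auto)
  then show ?thesis
    using f00 by (auto simp: h_def field_simps split: if_splits)
qed

text \<open>A mean value estimate starting from the axis \<open>x = 0\<close>, where
  \<open>f\<close> vanishes and its \<open>x\<close>-derivative is \<open>a\<close>.\<close>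

lemma f_near_q_axis:
  assumes "\<bar>x\<bar> < r" "\<bar>y\<bar> < r"
  shows "\<bar>f x y - a * x\<bar> \<le> C * \<bar>x\<bar> powr \<beta> * \<bar>x\<bar>"
proof -
  have "norm ((f x y - a * x) - (f 0 y - a * 0)) \<le> C * \<bar>x\<bar> powr \<beta> * norm (x - 0)"
  proof (rule field_differentiable_bound [where S = "{-\<bar>x\<bar>..\<bar>x\<bar>}" and f' = "\<lambda>z. fx z y - a"])
    fix z assume z: "z \<in> {-\<bar>x\<bar>..\<bar>x\<bar>}"
    then have zr: "\<bar>z\<bar> \<le> \<bar>x\<bar>" "\<bar>z\<bar> < r"
      using assms by auto
    show "((\<lambda>x. f x y - a * x) has_field_derivative fx z y - a) (at z within {-\<bar>x\<bar>..\<bar>x\<bar>})"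
      by (rule has_field_derivative_at_within, intro DERIV_diff dx zr assms DERIV_cmult_Id)
    have "\<bar>fx z y - a\<bar> \<le> C * \<bar>z\<bar> powr \<beta>"
      using holder [OF zr(2) assms(2)] fx_0_left [OF assms(2)] by simp
    also have "\<dots> \<le> C * \<bar>x\<bar> powr \<beta>"
      using zr \<beta> C by (intro mult_left_mono powr_mono2) auto
    finally show "norm (fx z y - a) \<le> C * \<bar>x\<bar> powr \<beta>"
      by simp
  qed auto
  then show ?thesis
    using f_0_left assms by simp
qed

lemma f_near_p_axis: "\<bar>x\<bar> < r \<Longrightarrow> \<bar>y\<bar> < r \<Longrightarrow> \<bar>f x y - a * x\<bar> \<le> C * \<bar>y\<bar>"
  using lip f_0_right by metis

section \<open>The orbit through a diagonal point\<close>

text \<open>The reverse triangle inequality reduces the distance to the diagonal to the difference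
  of the moduli, so the signs of \<open>lp\<close> and \<open>lq\<close> do not matter and the gap
  conditions apply.\<close>

lemma kick_orbit_eq_0:
  assumes "1 \<le> i"
  shows "kick \<alpha> \<delta> (s / lp ^ i) (s / lq ^ i) = 0"
    and "1 \<le> \<theta> \<Longrightarrow> \<theta> \<le> 1 + \<eta> \<Longrightarrow> kick \<alpha> \<delta> (lp ^ i * (s * \<theta>)) (lq ^ i * s) = 0"
proof -
  have "\<delta> * \<bar>s / lq ^ i\<bar> \<le> \<bar>\<bar>lq / lp\<bar> ^ i - 1\<bar> * \<bar>s / lq ^ i\<bar>"
    by (intro mult_right_mono gap1 assms) simp
  also have "\<dots> = \<bar>(\<bar>lq / lp\<bar> ^ i - 1) * \<bar>s / lq ^ i\<bar>\<bar>"
    by (simp add: abs_mult)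
  also have "(\<bar>lq / lp\<bar> ^ i - 1) * \<bar>s / lq ^ i\<bar> = \<bar>s / lp ^ i\<bar> - \<bar>s / lq ^ i\<bar>"
    using l by (simp add: power_abs abs_mult power_divide field_simps)
  also have "\<bar>\<dots>\<bar> \<le> \<bar>s / lp ^ i - s / lq ^ i\<bar>"
    by (rule abs_triangle_ineq3)
  finally show "kick \<alpha> \<delta> (s / lp ^ i) (s / lq ^ i) = 0"
    by (rule kick_eq_0 [OF \<delta>(1)])
  assume \<theta>: "1 \<le> \<theta>" "\<theta> \<le> 1 + \<eta>"
  have "\<delta> * \<bar>lq ^ i * s\<bar> \<le> \<bar>\<theta> / \<bar>lq / lp\<bar> ^ i - 1\<bar> * \<bar>lq ^ i * s\<bar>"
    by (intro mult_right_mono gap2 assms \<theta>) simp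
  also have "\<dots> = \<bar>(\<theta> / \<bar>lq / lp\<bar> ^ i - 1) * \<bar>lq ^ i * s\<bar>\<bar>"
    by (simp add: abs_mult)
  also have "(\<theta> / \<bar>lq / lp\<bar> ^ i - 1) * \<bar>lq ^ i * s\<bar> = \<bar>lp ^ i * (s * \<theta>)\<bar> - \<bar>lq ^ i * s\<bar>"
    using l \<theta> by (simp add: power_abs abs_mult power_divide field_simps)
  also have "\<bar>\<dots>\<bar> \<le> \<bar>lp ^ i * (s * \<theta>) - lq ^ i * s\<bar>"
    by (rule abs_triangle_ineq3)
  finally show "kick \<alpha> \<delta> (lp ^ i * (s * \<theta>)) (lq ^ i * s) = 0"
    by (rule kick_eq_0 [OF \<delta>(1)])
qed

text \<open>Each step starts at an index at least 1, outside the cone, so the past of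
  \<open>(s, s)\<close> is an orbit of the linear map.\<close>

lemma backward_orbit:
  assumes "\<And>i. i \<le> k \<Longrightarrow> \<bar>s / lp ^ i\<bar> < r \<and> \<bar>s / lq ^ i\<bar> < r"
  shows "f s s = lp ^ k * f (s / lp ^ k) (s / lq ^ k)"
  using assms
proof (induction k)
  case (Suc k)
  have "f (s / lp ^ k) (s / lq ^ k) = lp * f (s / lp ^ Suc k) (s / lq ^ Suc k)"
    using conj [of "s / lp ^ Suc k" "s / lq ^ Suc k"] Suc.prems [of k] Suc.prems [of "Suc k"] l
    by (simp only: kick_orbit_eq_0 add_0_right) simp
  moreover have "f s s = lp ^ k * f (s / lp ^ k) (s / lq ^ k)"
    using Suc by simp
  ultimately show ?case
    by simp
qed simp

text \<open>The first step starts at \<open>(s, s)\<close> and contributes the extra factor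
  \<open>\<theta>\<close>; the later ones are linear. The induction therefore begins at 1, since at
  time 0 the factor is not yet there.\<close>

lemma forward_orbit:
  assumes "0 < s" and \<theta>: "\<theta> = 1 + s powr \<alpha>" "\<theta> \<le> 1 + \<eta>" and "1 \<le> m"
    and "\<And>i. i \<le> m \<Longrightarrow> \<bar>lp ^ i * (s * \<theta>)\<bar> < r \<and> \<bar>lq ^ i * s\<bar> < r"
  shows "f (lp ^ m * (s * \<theta>)) (lq ^ m * s) = lp ^ m * f s s"
  using assms(4,5)
proof (induction m rule: dec_induct)
  case base
  have "s + kick \<alpha> \<delta> s s = s * \<theta>"
    using \<open>0 < s\<close> by (simp add: kick_diag \<theta> algebra_simps)
  moreover have "\<bar>s\<bar> < r" "\<bar>lp * (s * \<theta>)\<bar> < r" "\<bar>lq * s\<bar> < r"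
    using base [of 0] base [of 1] by simp_all
  ultimately show ?case
    using conj [of s s] by simp
next
  case (step m)
  have "1 \<le> \<theta>"
    by (simp add: \<theta>)
  then have "kick \<alpha> \<delta> (lp ^ m * (s * \<theta>)) (lq ^ m * s) = 0"
    using step.hyps \<theta>(2) by (intro kick_orbit_eq_0)
  moreover have "\<bar>lp ^ m * (s * \<theta>)\<bar> < r" "\<bar>lq ^ m * s\<bar> < r"
    using step.prems [of m] by simp_all
  moreover have "\<bar>lp * (lp ^ m * (s * \<theta>))\<bar> < r" "\<bar>lq * (lq ^ m * s)\<bar> < r"
    using step.prems [of "Suc m"] by (simp_all add: mult.assoc)
  ultimately have "f (lp * (lp ^ m * (s * \<theta>))) (lq * (lq ^ m * s)) = lp * f (lp ^ m * (s * \<theta>)) (lq ^ m * s)"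
    using conj by (metis add_0_right)
  also have "f (lp ^ m * (s * \<theta>)) (lq ^ m * s) = lp ^ m * f s s"
    using step by simp
  finally show ?case
    by (simp add: mult.assoc)
qed

text \<open>By the choice of \<open>s\<close>, following the orbit for \<open>N\<close> steps in the
  time direction in which the \<open>q\<close>-coordinate grows brings that coordinate to size
  \<open>r / 4\<close>; \<open>K\<close> steps the other way lead towards the \<open>p\<close>-axis.
  Comparing \<open>f s s / s\<close> with \<open>a\<close> at the past end and with
  \<open>a * \<theta>\<close> at the future end leaves
  \<open>\<bar>a\<bar> * (\<theta> - 1)\<close>.\<close>

lemma orbit_inequality:
  fixes N K :: nat
  defines "p \<equiv> \<bar>ln \<bar>lp\<bar>\<bar>" and "q \<equiv> \<bar>ln \<bar>lq\<bar>\<bar>"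
  defines "s \<equiv> r / 4 * exp (- q * N)"
  assumes K: "1 \<le> K" "p * K \<le> q * N" and small: "s powr \<alpha> \<le> min \<eta> 1"
  shows "\<bar>a\<bar> * s powr \<alpha> \<le> 4 * C * (r / 4 * exp (- (p + q) * N)) powr \<beta> + C * exp (- (p + q) * K)"
proof -
  define \<theta> where "\<theta> = 1 + s powr \<alpha>"
  define u where "u = f s s / s"
  have s: "0 < s"
    using r by (simp add: s_def)
  have \<theta>: "1 \<le> \<theta>" "\<theta> \<le> 2" "\<theta> \<le> 1 + \<eta>"
    using small by (auto simp: \<theta>_def)
  have "0 < p"
    using hyp l by (auto simp: p_def)
  have "1 \<le> N"
  proof -
    have "0 < p * real K"
      using K(1) \<open>0 < p\<close> by simp
    then show ?thesis
      using K(2) by (cases N) auto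
  qed
  have u: "f s s = s * u"
    using s by (simp add: u_def)
  have pow: "exp (x * real i) = exp x ^ i" for x i
    by (metis exp_of_nat_mult mult.commute)
  have top: "exp (q * N) * s = r / 4"
    by (simp add: s_def flip: exp_add)
  have "exp (p * K) * s \<le> exp (q * N) * s"
    using K s by (intro mult_right_mono) auto
  then have top': "exp (p * K) * s \<le> r / 4"
    using top by simp
  have decr: "exp (- x * i) * s \<le> r / 4" if "0 \<le> x" for x :: real and i :: nat
  proof -
    have "exp (- x * i) * s \<le> 1 * s"
      using that s by (intro mult_right_mono) auto
    also have "\<dots> \<le> exp (q * N) * s"
      using s by (intro mult_right_mono) (auto simp: q_def)
    finally show ?thesis
      using top by simp
  qed
  have incr: "exp (x * i) * s \<le> exp (x * n) * s" if "0 \<le> x" "i \<le> n" for x :: real and i n :: nat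
    using that s by (intro mult_right_mono) (auto intro: mult_left_mono)
  have "p \<ge> 0" "q \<ge> 0"
    by (auto simp: p_def q_def)
  \<comment> \<open>The factor 1/4 in \<open>s\<close> leaves room for
    \<open>\<theta> \<le> 2\<close>.\<close>
  have \<theta>r: "x * (s * \<theta>) < r" if "x * s \<le> r / 4" for x
  proof -
    have "x * s * \<theta> \<le> r / 4 * 2"
      using that \<theta> r by (intro mult_mono) auto
    also have "\<dots> < r"
      using r by simp
    finally show ?thesis
      by (simp add: mult.assoc)
  qed
  have sum: "\<bar>a\<bar> * s powr \<alpha> \<le> \<bar>u - a * \<theta>\<bar> + \<bar>u - a\<bar>"
  proof -
    have "\<bar>a\<bar> * s powr \<alpha> = \<bar>(u - a) - (u - a * \<theta>)\<bar>"
      by (simp add: \<theta>_def algebra_simps abs_mult)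
    then show ?thesis
      by linarith
  qed
  define t where "t = r / 4 * exp (- (p + q) * N)"
  have t: "t = exp (- p * N) * s" "0 < t"
    using r by (simp_all add: t_def s_def algebra_simps flip: exp_add)
  show ?thesis
    using hyp
  proof
    assume lt: "\<bar>lp\<bar> < 1 \<and> 1 < \<bar>lq\<bar>"
    \<comment> \<open>The future end, after the factor \<open>\<theta>\<close> is gained, lies near
      the \<open>q\<close>-axis and the past end near the \<open>p\<close>-axis.\<close>
    have P: "\<bar>lp\<bar> = exp (- p)" and Q: "\<bar>lq\<bar> = exp q"
      using lt l by (simp_all add: p_def q_def)
    have Pi: "\<bar>lp\<bar> ^ i = exp (- p * i)" and Qi: "\<bar>lq\<bar> ^ i = exp (q * i)" for i
      by (simp_all only: P Q pow)
    have fwd: "\<bar>lp ^ i * (s * \<theta>)\<bar> < r \<and> \<bar>lq ^ i * s\<bar> < r" if "i \<le> N" for i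
      using \<theta>r [OF decr [OF \<open>p \<ge> 0\<close>, of i]] incr [OF \<open>q \<ge> 0\<close> that] top s \<theta>(1) r
      by (simp add: abs_mult power_abs Pi Qi)
    have sl: "\<bar>s / lp ^ i\<bar> = exp (p * i) * s" "\<bar>s / lq ^ i\<bar> = exp (- q * i) * s" for i
      using s by (simp_all add: power_abs Pi Qi exp_minus field_simps)
    have bwd: "\<bar>s / lp ^ i\<bar> < r \<and> \<bar>s / lq ^ i\<bar> < r" if "i \<le> K" for i
      unfolding sl using incr [OF \<open>p \<ge> 0\<close> that] top' decr [OF \<open>q \<ge> 0\<close>, of i] r by linarith
    have "f (lp ^ N * (s * \<theta>)) (lq ^ N * s) = lp ^ N * f s s"
      using s \<theta>_def \<theta>(3) \<open>1 \<le> N\<close> fwd by (intro forward_orbit)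
    then have "\<bar>lp ^ N * f s s - a * (lp ^ N * (s * \<theta>))\<bar>
        \<le> C * \<bar>lp ^ N * (s * \<theta>)\<bar> powr \<beta> * \<bar>lp ^ N * (s * \<theta>)\<bar>"
      using f_near_q_axis fwd [of N] by (metis order_refl)
    also have "lp ^ N * f s s - a * (lp ^ N * (s * \<theta>)) = lp ^ N * s * (u - a * \<theta>)"
      by (simp add: u algebra_simps)
    also have "\<bar>\<dots>\<bar> = t * \<bar>u - a * \<theta>\<bar>"
      using s by (simp add: abs_mult power_abs Pi t)
    also have "\<bar>lp ^ N * (s * \<theta>)\<bar> = t * \<theta>"
      using s \<theta> by (simp add: abs_mult power_abs Pi t)
    finally have "t * \<bar>u - a * \<theta>\<bar> \<le> t * (C * (t * \<theta>) powr \<beta> * \<theta>)"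
      by (simp add: mult_ac)
    then have "\<bar>u - a * \<theta>\<bar> \<le> C * (t * \<theta>) powr \<beta> * \<theta>"
      using t(2) by simp
    \<comment> \<open>The bound \<open>\<theta> \<le> 2\<close> enters once inside the power and
      once as a factor; this is the origin of the constant 4.\<close>
    also have "\<dots> \<le> C * (2 * t powr \<beta>) * 2"
    proof (intro mult_mono mult_left_mono C)
      have "(t * \<theta>) powr \<beta> \<le> t powr \<beta> * 2 powr \<beta>"
        using t \<theta> \<beta> by (auto simp: powr_mult intro!: mult_left_mono powr_mono2)
      also have "\<dots> \<le> t powr \<beta> * 2"
        using powr_mono [of \<beta> 1 "2::real"] \<beta> by (intro mult_left_mono) auto
      finally show "(t * \<theta>) powr \<beta> \<le> 2 * t powr \<beta>"
        by simp
    qed (use C \<theta> in auto)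
    finally have 1: "\<bar>u - a * \<theta>\<bar> \<le> 4 * C * t powr \<beta>"
      by simp
    have "\<bar>f (s / lp ^ K) (s / lq ^ K) - a * (s / lp ^ K)\<bar> \<le> C * \<bar>s / lq ^ K\<bar>"
      using f_near_p_axis bwd [OF order_refl] by blast
    moreover have "f (s / lp ^ K) (s / lq ^ K) = s * u / lp ^ K"
      using backward_orbit [of K s] bwd l u by (simp add: field_simps)
    moreover have "s * u / lp ^ K - a * (s / lp ^ K) = s / lp ^ K * (u - a)"
      by (simp add: algebra_simps diff_divide_distrib)
    ultimately have "\<bar>s / lp ^ K * (u - a)\<bar> \<le> C * \<bar>s / lq ^ K\<bar>"
      by metis
    then have "s * (exp (p * K) * \<bar>u - a\<bar>) \<le> s * (C * exp (- q * K))"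
      unfolding abs_mult sl by (simp only: mult_ac)
    then have "exp (p * K) * \<bar>u - a\<bar> \<le> C * exp (- q * K)"
      using s by (simp only: mult_le_cancel_left_pos)
    then have "exp (- p * K) * (exp (p * K) * \<bar>u - a\<bar>) \<le> exp (- p * K) * (C * exp (- q * K))"
      by (intro mult_left_mono) auto
    also have "exp (- p * K) * (exp (p * K) * \<bar>u - a\<bar>) = \<bar>u - a\<bar>"
      by (simp add: exp_minus)
    also have "exp (- p * K) * (C * exp (- q * K)) = C * exp (- (p + q) * K)"
      by (simp add: algebra_simps flip: exp_add)
    finally show ?thesis
      using sum 1 unfolding t_def by linarith
  next
    assume lt: "\<bar>lq\<bar> < 1 \<and> 1 < \<bar>lp\<bar>"
    \<comment> \<open>Time is reversed: now the past end lies near the \<open>q\<close>-axis and the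
      future end, with the factor \<open>\<theta>\<close>, near the \<open>p\<close>-axis.\<close>
    have P: "\<bar>lp\<bar> = exp p" and Q: "\<bar>lq\<bar> = exp (- q)"
      using lt l by (simp_all add: p_def q_def)
    have Pi: "\<bar>lp\<bar> ^ i = exp (p * i)" and Qi: "\<bar>lq\<bar> ^ i = exp (- q * i)" for i
      by (simp_all only: P Q pow)
    have fwd: "\<bar>lp ^ i * (s * \<theta>)\<bar> < r \<and> \<bar>lq ^ i * s\<bar> < r" if "i \<le> K" for i
    proof -
      have "exp (p * i) * (s * \<theta>) < r"
        using incr [OF \<open>p \<ge> 0\<close> that] top' by (intro \<theta>r) simp
      then show ?thesis
        using decr [OF \<open>q \<ge> 0\<close>, of i] s \<theta>(1) r by (simp add: abs_mult power_abs Pi Qi)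
    qed
    have sl: "\<bar>s / lp ^ i\<bar> = exp (- p * i) * s" "\<bar>s / lq ^ i\<bar> = exp (q * i) * s" for i
      using s by (simp_all add: power_abs Pi Qi exp_minus field_simps)
    have bwd: "\<bar>s / lp ^ i\<bar> < r \<and> \<bar>s / lq ^ i\<bar> < r" if "i \<le> N" for i
      unfolding sl using incr [OF \<open>q \<ge> 0\<close> that] top decr [OF \<open>p \<ge> 0\<close>, of i] r by linarith
    have "\<bar>f (s / lp ^ N) (s / lq ^ N) - a * (s / lp ^ N)\<bar> \<le> C * \<bar>s / lp ^ N\<bar> powr \<beta> * \<bar>s / lp ^ N\<bar>"
      using f_near_q_axis bwd [OF order_refl] by blast
    moreover have "f (s / lp ^ N) (s / lq ^ N) = s * u / lp ^ N"
      using backward_orbit [of N s] bwd l u by (simp add: field_simps)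
    moreover have "s * u / lp ^ N - a * (s / lp ^ N) = s / lp ^ N * (u - a)"
      by (simp add: algebra_simps diff_divide_distrib)
    ultimately have "\<bar>s / lp ^ N * (u - a)\<bar> \<le> C * \<bar>s / lp ^ N\<bar> powr \<beta> * \<bar>s / lp ^ N\<bar>"
      by metis
    moreover have tN: "\<bar>s / lp ^ N\<bar> = t"
      using s by (simp add: power_abs Pi t exp_minus field_simps)
    ultimately have "t * \<bar>u - a\<bar> \<le> t * (C * t powr \<beta>)"
      by (simp only: abs_mult tN mult_ac)
    then have "\<bar>u - a\<bar> \<le> C * t powr \<beta>"
      using t(2) by simp
    also have "\<dots> \<le> 4 * C * t powr \<beta>"
      using C by simp
    finally have 1: "\<bar>u - a\<bar> \<le> 4 * C * t powr \<beta>" .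
    have "f (lp ^ K * (s * \<theta>)) (lq ^ K * s) = lp ^ K * f s s"
      using s \<theta>_def \<theta>(3) K(1) fwd by (intro forward_orbit)
    then have "\<bar>lp ^ K * f s s - a * (lp ^ K * (s * \<theta>))\<bar> \<le> C * \<bar>lq ^ K * s\<bar>"
      using f_near_p_axis fwd [of K] by (metis order_refl)
    also have "lp ^ K * f s s - a * (lp ^ K * (s * \<theta>)) = lp ^ K * s * (u - a * \<theta>)"
      by (simp add: u algebra_simps)
    also have "\<bar>\<dots>\<bar> = s * (exp (p * K) * \<bar>u - a * \<theta>\<bar>)"
      using s by (simp add: abs_mult power_abs Pi)
    also have "C * \<bar>lq ^ K * s\<bar> = s * (C * exp (- q * K))"
      using s by (simp add: abs_mult power_abs Qi)
    finally have "exp (p * K) * \<bar>u - a * \<theta>\<bar> \<le> C * exp (- q * K)"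
      using s by (simp only: mult_le_cancel_left_pos)
    then have "exp (- p * K) * (exp (p * K) * \<bar>u - a * \<theta>\<bar>) \<le> exp (- p * K) * (C * exp (- q * K))"
      by (intro mult_left_mono) auto
    also have "exp (- p * K) * (exp (p * K) * \<bar>u - a * \<theta>\<bar>) = \<bar>u - a * \<theta>\<bar>"
      by (simp add: exp_minus)
    also have "exp (- p * K) * (C * exp (- q * K)) = C * exp (- (p + q) * K)"
      by (simp add: algebra_simps flip: exp_add)
    finally show ?thesis
      using sum 1 unfolding t_def by linarith
  qed
qed

lemma exponent_bound:
  assumes "a \<noteq> 0"
  shows "\<beta> \<le> \<alpha> * \<bar>ln \<bar>lq\<bar>\<bar> / (\<bar>ln \<bar>lp\<bar>\<bar> + \<bar>ln \<bar>lq\<bar>\<bar>)"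
proof -
  define p q where "p = \<bar>ln \<bar>lp\<bar>\<bar>" and "q = \<bar>ln \<bar>lq\<bar>\<bar>"
  have pq: "0 < p" "0 < q"
    using hyp l by (auto simp: p_def q_def)
  have "(\<lambda>N. exp (- q) ^ N) \<longlonglongrightarrow> 0"
    using pq by (intro LIMSEQ_power_zero) simp
  then have "(\<lambda>N. r / 4 * exp (- q * real N)) \<longlonglongrightarrow> r / 4 * 0"
    by (intro tendsto_intros) (simp add: exp_of_nat_mult [symmetric] mult.commute)
  then have "(\<lambda>N. (r / 4 * exp (- q * real N)) powr \<alpha>) \<longlonglongrightarrow> (r / 4 * 0) powr \<alpha>"
    using \<alpha> r by (intro tendsto_powr2 tendsto_const) auto
  then have "(\<lambda>N. (r / 4 * exp (- q * real N)) powr \<alpha>) \<longlonglongrightarrow> 0"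
    by simp
  then have "\<forall>\<^sub>F N in sequentially. (r / 4 * exp (- q * real N)) powr \<alpha> < min \<eta> 1"
    using \<open>0 < \<eta>\<close> by (intro order_tendstoD) auto
  then obtain N\<^sub>0 where N\<^sub>0: "\<And>N. N\<^sub>0 \<le> N \<Longrightarrow> (r / 4 * exp (- q * real N)) powr \<alpha> < min \<eta> 1"
    unfolding eventually_sequentially by blast
  have ep: "(r / 4 * exp x) powr e = (r / 4) powr e * exp (x * e)" for x e
    using r by (subst powr_mult) (auto simp: powr_def mult.commute)
  have "\<beta> \<le> \<alpha> * q / (p + q)"
  proof (rule exponential_rate_bound [OF pq \<alpha>(2), where c = "\<bar>a\<bar> * (r / 4) powr \<alpha>"
        and C = "4 * C * (r / 4) powr \<beta>" and D = C and N\<^sub>0 = N\<^sub>0])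
    fix N K :: nat assume "N\<^sub>0 \<le> N" "1 \<le> K" "p * real K \<le> q * real N"
    then have "\<bar>a\<bar> * (r / 4 * exp (- q * N)) powr \<alpha>
        \<le> 4 * C * (r / 4 * exp (- (p + q) * N)) powr \<beta> + C * exp (- (p + q) * K)"
      using orbit_inequality [of K N] N\<^sub>0 [of N] unfolding p_def q_def by simp
    then show "\<bar>a\<bar> * (r / 4) powr \<alpha> * exp (- \<alpha> * q * N)
        \<le> 4 * C * (r / 4) powr \<beta> * exp (- (p + q) * \<beta> * N) + C * exp (- (p + q) * K)"
      unfolding ep by (simp add: mult_ac)
  qed (use assms r in auto)
  then show ?thesis
    by (simp add: p_def q_def)
qed

end

section \<open>The counterexample\<close>

lemma diag2_mult_vec: "diag2 a b *v v = (\<chi> i. (if i = 1 then a else b) * v $ i)"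
  by (simp add: vec_eq_iff forall_2 diag2_def matrix_vector_mult_def sum_2)

text \<open>With abstract axes both cases of \<open>beta_star\<close> become one statement with
  \<open>p\<close> and \<open>q\<close> exchanged. The bound holds for either choice, and the
  theorem takes the smaller one.\<close>

lemma conjugacy_counterexample:
  fixes l :: "2 \<Rightarrow> real" and p q :: 2 and \<alpha> :: real
  defines "\<Lambda> \<equiv> \<lambda>v::real^2. \<chi> i. l i * v $ i"
  assumes \<alpha>: "0 < \<alpha>" "\<alpha> \<le> 1" and "p \<noteq> q" and l0: "l p \<noteq> 0" "l q \<noteq> 0"
    and hyp: "\<bar>l p\<bar> < 1 \<and> 1 < \<bar>l q\<bar> \<or> \<bar>l q\<bar> < 1 \<and> 1 < \<bar>l p\<bar>"
  shows "\<exists>F :: real^2 \<Rightarrow> real^2.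
    (\<exists>U. 0 \<in> U \<and> C1_holder_diffeo_on \<alpha> U F) \<and> F 0 = 0 \<and> (F has_derivative \<Lambda>) (at 0) \<and>
    (\<forall>\<beta> (\<Phi> :: real^2 \<Rightarrow> real^2) V. 0 < \<beta> \<longrightarrow> \<beta> \<le> 1 \<longrightarrow> 0 \<in> V \<longrightarrow> C1_holder_diffeo_on \<beta> V \<Phi> \<longrightarrow>
       (\<forall>\<^sub>F x in nhds 0. \<Phi> (F x) = \<Lambda> (\<Phi> x)) \<longrightarrow>
       \<beta> \<le> \<alpha> * \<bar>ln \<bar>l q\<bar>\<bar> / (\<bar>ln \<bar>l p\<bar>\<bar> + \<bar>ln \<bar>l q\<bar>\<bar>))"
proof -
  have pq: "i = p \<or> i = q" for i :: 2
    using \<open>p \<noteq> q\<close> exhaust_2 by metis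
  have lne: "\<bar>l q\<bar> \<noteq> \<bar>l p\<bar>"
    using hyp by auto
  have "0 < \<bar>l q / l p\<bar>" "\<bar>l q / l p\<bar> \<noteq> 1"
    using l0 lne by auto
  then obtain \<delta> \<eta> where \<delta>: "0 < \<delta>" "\<delta> < 1" and "0 < \<eta>"
    and gap1: "\<And>i. 1 \<le> i \<Longrightarrow> \<delta> \<le> \<bar>\<bar>l q / l p\<bar> ^ i - 1\<bar>"
    and gap2: "\<And>i \<theta>. 1 \<le> i \<Longrightarrow> 1 \<le> \<theta> \<Longrightarrow> \<theta> \<le> 1 + \<eta> \<Longrightarrow> \<delta> \<le> \<bar>\<theta> / \<bar>l q / l p\<bar> ^ i - 1\<bar>"
    by (rule gap_exists) blast
  define e :: "2 \<Rightarrow> real^2" where "e i = axis i 1" for i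
  have e: "e i $ j = (if i = j then 1 else 0)" "norm (e i) = 1" for i j
    by (simp_all add: e_def norm_axis_1) (simp add: axis_def)
  \<comment> \<open>The factor \<open>l p\<close> makes \<open>F\<close> the composition of
    \<open>\<Lambda>\<close> with the change of the \<open>p\<close>-coordinate by
    \<open>kick\<close>.\<close>
  define F where "F v = \<Lambda> v + (l p * kick \<alpha> \<delta> (v $ p) (v $ q)) *\<^sub>R e p" for v
  have lin\<Lambda>: "bounded_linear \<Lambda>"
    unfolding linear_conv_bounded_linear [symmetric] \<Lambda>_def
    by (rule linearI) (auto simp: vec_eq_iff algebra_simps)
  define L where "L = Blinfun \<Lambda>"
  define E where "E i = Blinfun (\<lambda>h. h $ i *\<^sub>R e p)" for i :: 2
  have L: "blinfun_apply L = \<Lambda>"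
    by (simp add: L_def bounded_linear_Blinfun_apply lin\<Lambda>)
  have E: "blinfun_apply (E i) = (\<lambda>h. h $ i *\<^sub>R e p)" for i :: 2
    unfolding E_def
    by (intro bounded_linear_Blinfun_apply bounded_linear_scaleR_const bounded_linear_vec_nth)
  define DF where "DF v = L + (l p * kick_dx \<alpha> \<delta> (v $ p) (v $ q)) *\<^sub>R E p
      + (l p * kick_dy \<alpha> \<delta> (v $ p) (v $ q)) *\<^sub>R E q" for v
  have DF: "(F has_derivative blinfun_apply (DF v)) (at v)" for v
  proof -
    have "((\<lambda>v. (l p * kick \<alpha> \<delta> (v $ p) (v $ q)) *\<^sub>R e p) has_derivative
        (\<lambda>h. (l p * (kick_dx \<alpha> \<delta> (v $ p) (v $ q) * h $ p + kick_dy \<alpha> \<delta> (v $ p) (v $ q) * h $ q)) *\<^sub>R e p)) (at v)"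
      by (intro has_derivative_scaleR_left has_derivative_mult_right has_derivative_kick
          \<alpha> \<delta> bounded_linear_vec_nth)
    from has_derivative_add [OF bounded_linear_imp_has_derivative [OF lin\<Lambda>] this]
    show ?thesis
      unfolding F_def [abs_def]
      by (rule has_derivative_eq_rhs)
        (simp add: fun_eq_iff DF_def L E blinfun.add_left blinfun.scaleR_left algebra_simps)
  qed
  obtain C where "0 \<le> C"
    and C: "\<And>x y x' y' d. \<bar>x - x'\<bar> \<le> d \<Longrightarrow> \<bar>y - y'\<bar> \<le> d
      \<Longrightarrow> \<bar>kick_dx \<alpha> \<delta> x y - kick_dx \<alpha> \<delta> x' y'\<bar> \<le> C * d powr \<alpha>
        \<and> \<bar>kick_dy \<alpha> \<delta> x y - kick_dy \<alpha> \<delta> x' y'\<bar> \<le> C * d powr \<alpha>"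
    using kick_holder [OF \<alpha> \<delta>] by blast
  have "C1_holder_on \<alpha> UNIV F"
  proof (rule C1_holder_onI [OF \<alpha>(1) DF])
    fix v w :: "real^2"
    let ?n = "norm (v - w)"
    let ?dx = "kick_dx \<alpha> \<delta> (v $ p) (v $ q) - kick_dx \<alpha> \<delta> (w $ p) (w $ q)"
    let ?dy = "kick_dy \<alpha> \<delta> (v $ p) (v $ q) - kick_dy \<alpha> \<delta> (w $ p) (w $ q)"
    have d: "\<bar>?dx\<bar> \<le> C * ?n powr \<alpha> \<and> \<bar>?dy\<bar> \<le> C * ?n powr \<alpha>"
      by (intro C) (metis component_le_norm_cart vector_minus_component)+
    have "DF v - DF w = (l p * ?dx) *\<^sub>R E p + (l p * ?dy) *\<^sub>R E q"
      by (simp add: DF_def algebra_simps)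
    also have "norm \<dots> \<le> \<bar>l p\<bar> * \<bar>?dx\<bar> * norm (E p) + \<bar>l p\<bar> * \<bar>?dy\<bar> * norm (E q)"
      by (rule order_trans [OF norm_triangle_ineq]) (simp add: abs_mult)
    also have "\<dots> \<le> \<bar>l p\<bar> * (C * ?n powr \<alpha>) * norm (E p) + \<bar>l p\<bar> * (C * ?n powr \<alpha>) * norm (E q)"
      using d by (intro add_mono mult_right_mono mult_left_mono) auto
    finally show "norm (DF v - DF w) \<le> \<bar>l p\<bar> * C * (norm (E p) + norm (E q)) * ?n powr \<alpha>"
      by (simp add: algebra_simps)
  qed
  moreover have "blinfun_apply (DF 0) = \<Lambda>"
    by (simp add: DF_def kick_dx_def kick_dy_def L)
  then have D0: "(F has_derivative \<Lambda>) (at 0)"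
    using DF [of 0] by simp
  moreover have "inj \<Lambda>"
  proof (rule injI)
    fix v w assume "\<Lambda> v = \<Lambda> w"
    then have "l i * v $ i = l i * w $ i" for i
      by (simp add: \<Lambda>_def vec_eq_iff)
    then have "v $ i = w $ i" for i
      using pq [of i] l0 by auto
    then show "v = w"
      by (simp add: vec_eq_iff)
  qed
  ultimately have diffeo: "\<exists>U. 0 \<in> U \<and> C1_holder_diffeo_on \<alpha> U F"
    using C1_holder_local_diffeo [of \<alpha> UNIV F 0 \<Lambda>] \<alpha> by simp
  have F0: "F 0 = 0"
    by (simp add: F_def \<Lambda>_def kick_def vec_eq_iff)

  have "\<beta> \<le> \<alpha> * \<bar>ln \<bar>l q\<bar>\<bar> / (\<bar>ln \<bar>l p\<bar>\<bar> + \<bar>ln \<bar>l q\<bar>\<bar>)"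
    if \<beta>: "0 < \<beta>" "\<beta> \<le> 1" and "0 \<in> V" and \<Phi>: "C1_holder_diffeo_on \<beta> V \<Phi>"
      and conj: "\<forall>\<^sub>F x in nhds 0. \<Phi> (F x) = \<Lambda> (\<Phi> x)"
    for \<beta> V and \<Phi> :: "real^2 \<Rightarrow> real^2"
  proof -
    have "open V" and openI: "open (\<Phi> ` V)" and "inj_on \<Phi> V" and h\<Phi>: "C1_holder_on \<beta> V \<Phi>"
      and h\<Psi>: "C1_holder_on \<beta> (\<Phi> ` V) (inv_into V \<Phi>)"
      using \<Phi> by (auto simp: C1_holder_diffeo_on_def)
    obtain D\<Phi> :: "real^2 \<Rightarrow> ((real^2) \<Rightarrow>\<^sub>L (real^2))" and C where "0 \<le> C" and cont: "continuous_on V D\<Phi>"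
      and der: "\<And>x. x \<in> V \<Longrightarrow> (\<Phi> has_derivative blinfun_apply (D\<Phi> x)) (at x)"
      and holder: "\<And>x y. x \<in> V \<Longrightarrow> y \<in> V \<Longrightarrow> norm (D\<Phi> x - D\<Phi> y) \<le> C * norm (x - y) powr \<beta>"
      using C1_holder_onE [OF h\<Phi>] by metis
    obtain D\<Psi> :: "real^2 \<Rightarrow> ((real^2) \<Rightarrow>\<^sub>L (real^2))"
      where der\<Psi>: "\<And>x. x \<in> \<Phi> ` V \<Longrightarrow> (inv_into V \<Phi> has_derivative blinfun_apply (D\<Psi> x)) (at x)"
      using C1_holder_onE [OF h\<Psi>] by metis
    have "\<forall>\<^sub>F x in nhds 0. x \<in> V \<and> \<Phi> (F x) = \<Lambda> (\<Phi> x)"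
      using conj eventually_nhds_in_open [OF \<open>open V\<close> \<open>0 \<in> V\<close>] by eventually_elim simp
    then obtain \<rho> where "0 < \<rho>" and \<rho>: "\<And>x. norm x < \<rho> \<Longrightarrow> x \<in> V \<and> \<Phi> (F x) = \<Lambda> (\<Phi> x)"
      unfolding eventually_nhds_metric by auto
    \<comment> \<open>Points with both coordinates below \<open>r\<close> in modulus have norm below
      \<open>2 * r\<close>, hence lie in the ball of radius \<open>\<rho>\<close>.\<close>
    define r where "r = min 1 (\<rho> / 2)"
    have r: "0 < r" "r \<le> 1" "2 * r \<le> \<rho>"
      using \<open>0 < \<rho>\<close> by (auto simp: r_def)
    define w where "w x y = x *\<^sub>R e p + y *\<^sub>R e q" for x y
    have w: "w x y $ p = x" "w x y $ q = y" for x y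
      using \<open>p \<noteq> q\<close> by (auto simp: w_def e)
    have v_eq: "v = w (v $ p) (v $ q)" for v
      unfolding vec_eq_iff using w pq by metis
    have norm_w: "norm (w x y) < 2 * r" if "\<bar>x\<bar> < r" "\<bar>y\<bar> < r" for x y
      using norm_triangle_ineq [of "x *\<^sub>R e p" "y *\<^sub>R e q"] that by (simp add: w_def e)
    have wV: "w x y \<in> V" and w_conj: "\<Phi> (F (w x y)) = \<Lambda> (\<Phi> (w x y))" if "\<bar>x\<bar> < r" "\<bar>y\<bar> < r" for x y
      using \<rho> [of "w x y"] norm_w [OF that] r by auto
    have Fw: "F (w x y) = w (l p * (x + kick \<alpha> \<delta> x y)) (l q * y)" for x y
    proof -
      have "F (w x y) $ p = l p * (x + kick \<alpha> \<delta> x y)" "F (w x y) $ q = l q * y"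
        using \<open>p \<noteq> q\<close> by (simp_all add: F_def \<Lambda>_def w e algebra_simps)
      then show ?thesis
        using v_eq by metis
    qed
    define f where "f x y = \<Phi> (w x y) $ p" for x y
    define fx where "fx x y = D\<Phi> (w x y) (e p) $ p" for x y
    \<comment> \<open>The Hoelder bound at the origin bounds \<open>D\<Phi>\<close> on the ball of
      radius \<open>2 * r\<close>, and the mean value inequality applies.\<close>
    have lip: "\<exists>M\<ge>0. \<forall>x y. \<bar>x\<bar> < r \<longrightarrow> \<bar>y\<bar> < r \<longrightarrow> \<bar>f x y - f x 0\<bar> \<le> M * \<bar>y\<bar>"
    proof (intro exI conjI allI impI)
      let ?M = "norm (D\<Phi> 0) + C * (2 * r) powr \<beta>"
      show "0 \<le> ?M"
        using \<open>0 \<le> C\<close> by simp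
      fix x y assume xy: "\<bar>x\<bar> < r" "\<bar>y\<bar> < r"
      have "norm (\<Phi> (w x y) - \<Phi> (w x 0)) \<le> ?M * norm (w x y - w x 0)"
      proof (rule differentiable_bound)
        show "convex (ball (0::real^2) (2 * r))"
          by simp
        fix z :: "real^2" assume z: "z \<in> ball 0 (2 * r)"
        then have zV: "z \<in> V"
          using \<rho> r by auto
        then show "(\<Phi> has_derivative D\<Phi> z) (at z within ball 0 (2 * r))"
          by (rule has_derivative_at_withinI [OF der])
        have "norm (D\<Phi> z) \<le> norm (D\<Phi> 0) + norm (D\<Phi> z - D\<Phi> 0)"
          by (metis add.commute diff_add_cancel norm_triangle_ineq)
        also have "norm (D\<Phi> z - D\<Phi> 0) \<le> C * norm (z - 0) powr \<beta>"
          by (intro holder zV \<open>0 \<in> V\<close>)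
        also have "\<dots> \<le> C * (2 * r) powr \<beta>"
          using z \<beta> \<open>0 \<le> C\<close> by (intro mult_left_mono powr_mono2) auto
        finally show "onorm (blinfun_apply (D\<Phi> z)) \<le> ?M"
          by (simp add: norm_blinfun.rep_eq)
      qed (use norm_w [of x y] norm_w [of x 0] xy r in auto)
      also have "norm (w x y - w x 0) = \<bar>y\<bar>"
        by (simp add: w_def e)
      finally have "norm (\<Phi> (w x y) - \<Phi> (w x 0)) \<le> ?M * \<bar>y\<bar>" .
      moreover have "\<bar>f x y - f x 0\<bar> \<le> norm (\<Phi> (w x y) - \<Phi> (w x 0))"
        using component_le_norm_cart [of "\<Phi> (w x y) - \<Phi> (w x 0)" p] by (simp add: f_def)
      ultimately show "\<bar>f x y - f x 0\<bar> \<le> ?M * \<bar>y\<bar>"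
        by (rule order_trans [rotated])
    qed
    then obtain M where "0 \<le> M" and M: "\<And>x y. \<bar>x\<bar> < r \<Longrightarrow> \<bar>y\<bar> < r \<Longrightarrow> \<bar>f x y - f x 0\<bar> \<le> M * \<bar>y\<bar>"
      by blast
    have dx: "((\<lambda>x. f x y) has_real_derivative fx x y) (at x)" if "\<bar>x\<bar> < r" "\<bar>y\<bar> < r" for x y
    proof -
      have "((\<lambda>x. w x y) has_derivative (\<lambda>h. h *\<^sub>R e p)) (at x)"
        unfolding w_def by (auto intro!: derivative_eq_intros)
      from has_derivative_compose [OF this der [OF wV [OF that]]]
      have "((\<lambda>x. \<Phi> (w x y)) has_derivative (\<lambda>h. D\<Phi> (w x y) (h *\<^sub>R e p))) (at x)" .
      from bounded_linear.has_derivative [OF bounded_linear_vec_nth this, of p]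
      show ?thesis
        unfolding has_field_derivative_def f_def fx_def
        by (rule has_derivative_eq_rhs) (simp add: fun_eq_iff blinfun.scaleR_right)
    qed
    have hol: "\<bar>fx x y - fx 0 y\<bar> \<le> C * \<bar>x\<bar> powr \<beta>" if "\<bar>x\<bar> < r" "\<bar>y\<bar> < r" for x y
    proof -
      have "\<bar>fx x y - fx 0 y\<bar> = \<bar>(D\<Phi> (w x y) - D\<Phi> (w 0 y)) (e p) $ p\<bar>"
        by (simp add: fx_def blinfun.diff_left)
      also have "\<dots> \<le> norm ((D\<Phi> (w x y) - D\<Phi> (w 0 y)) (e p))"
        by (rule component_le_norm_cart)
      also have "\<dots> \<le> norm (D\<Phi> (w x y) - D\<Phi> (w 0 y))"
        using norm_blinfun [of "D\<Phi> (w x y) - D\<Phi> (w 0 y)" "e p"] by (simp add: e)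
      also have "\<dots> \<le> C * norm (w x y - w 0 y) powr \<beta>"
        using that r by (intro holder wV) auto
      also have "norm (w x y - w 0 y) = \<bar>x\<bar>"
        by (simp add: w_def e)
      finally show ?thesis .
    qed
    have w00: "w 0 0 = 0"
      by (simp add: w_def)
    have "isCont D\<Phi> (w 0 0)"
      using cont \<open>open V\<close> \<open>0 \<in> V\<close> w00 by (simp add: continuous_on_eq_continuous_at)
    moreover have "isCont (\<lambda>y. w 0 y) 0"
      unfolding w_def by (intro continuous_intros)
    ultimately have "isCont (\<lambda>y. D\<Phi> (w 0 y)) 0"
      by (rule isCont_o2 [rotated])
    then have cfx: "isCont (fx 0) 0"
      unfolding fx_def [abs_def] by (intro continuous_intros)
    \<comment> \<open>Differentiating the conjugacy at 0 shows that \<open>D\<Phi> 0\<close>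
      commutes with \<open>\<Lambda>\<close>. As the eigenvalues differ, the off-diagonal entry in
      row \<open>p\<close> vanishes. If the diagonal entry \<open>fx 0 0\<close> vanished too, the
      whole row would, contradicting the differentiable inverse of \<open>\<Phi>\<close>.\<close>
    have "fx 0 0 \<noteq> 0"
    proof
      assume a: "fx 0 0 = 0"
      have "((\<lambda>v. \<Phi> (F v)) has_derivative (\<lambda>h. D\<Phi> 0 (\<Lambda> h))) (at 0)"
        using has_derivative_compose [OF D0, of \<Phi> "blinfun_apply (D\<Phi> 0)"] der [OF \<open>0 \<in> V\<close>] F0 by simp
      moreover have "((\<lambda>v. \<Phi> (F v)) has_derivative (\<lambda>h. \<Lambda> (D\<Phi> 0 h))) (at 0)"
      proof (rule has_derivative_transform_within_open)
        show "((\<lambda>v. \<Lambda> (\<Phi> v)) has_derivative (\<lambda>h. \<Lambda> (D\<Phi> 0 h))) (at 0)"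
          by (intro bounded_linear.has_derivative [OF lin\<Lambda>] der \<open>0 \<in> V\<close>)
      qed (use \<rho> \<open>0 < \<rho>\<close> in \<open>auto intro: open_ball [of 0 \<rho>]\<close>)
      ultimately have "(\<lambda>h. D\<Phi> 0 (\<Lambda> h)) = (\<lambda>h. \<Lambda> (D\<Phi> 0 h))"
        by (rule has_derivative_unique)
      then have "D\<Phi> 0 (\<Lambda> (e q)) $ p = \<Lambda> (D\<Phi> 0 (e q)) $ p"
        by metis
      moreover have "\<Lambda> (e q) = l q *\<^sub>R e q"
        by (simp add: \<Lambda>_def vec_eq_iff e)
      ultimately have "l q * D\<Phi> 0 (e q) $ p = l p * D\<Phi> 0 (e q) $ p"
        by (simp add: blinfun.scaleR_right \<Lambda>_def)
      then have b: "D\<Phi> 0 (e q) $ p = 0"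
        using lne by auto
      have zero: "D\<Phi> 0 k $ p = 0" for k
      proof -
        have "D\<Phi> 0 k = k $ p *\<^sub>R D\<Phi> 0 (e p) + k $ q *\<^sub>R D\<Phi> 0 (e q)"
          by (subst v_eq [of k]) (simp add: w_def blinfun.add_right blinfun.scaleR_right)
        then show ?thesis
          using a b by (simp add: fx_def w00)
      qed
      have inv0: "inv_into V \<Phi> (\<Phi> 0) = 0"
        using \<open>inj_on \<Phi> V\<close> \<open>0 \<in> V\<close> by simp
      have "((\<lambda>z. \<Phi> (inv_into V \<Phi> z)) has_derivative (\<lambda>h. D\<Phi> 0 (D\<Psi> (\<Phi> 0) h))) (at (\<Phi> 0))"
        using has_derivative_compose [OF der\<Psi>, of "\<Phi> 0" \<Phi> "blinfun_apply (D\<Phi> 0)"]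
          der [OF \<open>0 \<in> V\<close>] inv0 \<open>0 \<in> V\<close> by simp
      moreover have "((\<lambda>z. \<Phi> (inv_into V \<Phi> z)) has_derivative (\<lambda>h. h)) (at (\<Phi> 0))"
      proof (rule has_derivative_transform_within_open [OF has_derivative_ident openI])
        show "z = \<Phi> (inv_into V \<Phi> z)" if "z \<in> \<Phi> ` V" for z
          using that by (simp add: f_inv_into_f)
      qed (use \<open>0 \<in> V\<close> in auto)
      ultimately have "(\<lambda>h. D\<Phi> 0 (D\<Psi> (\<Phi> 0) h)) = (\<lambda>h. h)"
        by (rule has_derivative_unique)
      then have "D\<Phi> 0 (D\<Psi> (\<Phi> 0) (e p)) $ p = e p $ p"
        by metis
      then show False
        using zero by (simp add: e)
    qed
    show ?thesis
    proof (rule exponent_bound [where f = f and fx = fx and r = r and C = "max M C" and \<delta> = \<delta> and \<eta> = \<eta>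
            and lp = "l p" and lq = "l q" and \<alpha> = \<alpha> and a = "fx 0 0"])
      show "\<bar>f x y - f x 0\<bar> \<le> max M C * \<bar>y\<bar>" if "\<bar>x\<bar> < r" "\<bar>y\<bar> < r" for x y
        by (rule order_trans [OF M [OF that]]) (simp add: mult_right_mono)
      show "\<bar>fx x y - fx 0 y\<bar> \<le> max M C * \<bar>x\<bar> powr \<beta>" if "\<bar>x\<bar> < r" "\<bar>y\<bar> < r" for x y
        by (rule order_trans [OF hol [OF that]]) (simp add: mult_right_mono)
      show "f (l p * (x + kick \<alpha> \<delta> x y)) (l q * y) = l p * f x y" if "\<bar>x\<bar> < r" "\<bar>y\<bar> < r" for x y
        using w_conj [OF that] by (simp add: f_def Fw \<Lambda>_def)
    qed (use \<alpha> \<beta> \<delta> \<open>0 < \<eta>\<close> r \<open>0 \<le> M\<close> l0 hyp gap1 gap2 dx cfx \<open>fx 0 0 \<noteq> 0\<close> in auto)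
  qed
  then show ?thesis
    using diffeo F0 D0 by (intro exI [of _ F]) blast
qed

theorem theorem4:
  fixes l1 l2 \<alpha> :: real
  assumes "0 < \<bar>l1\<bar>" and "\<bar>l1\<bar> < 1" and "1 < \<bar>l2\<bar>"
    and "0 < \<alpha>" and "\<alpha> \<le> 1"
  shows "\<exists>F :: real^2 \<Rightarrow> real^2.
    (\<exists>U. 0 \<in> U \<and> C1_holder_diffeo_on \<alpha> U F) \<and>
    F 0 = 0 \<and>
    (F has_derivative (\<lambda>v. diag2 l1 l2 *v v)) (at 0) \<and>
    (\<forall>(\<beta>::real) (\<Phi> :: real^2 \<Rightarrow> real^2) V.
       0 < \<beta> \<longrightarrow> \<beta> \<le> 1 \<longrightarrow>
       0 \<in> V \<longrightarrow> C1_holder_diffeo_on \<beta> V \<Phi> \<longrightarrow>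
       (\<forall>\<^sub>F x in nhds 0. \<Phi> (F x) = diag2 l1 l2 *v \<Phi> x) \<longrightarrow>
       \<beta> \<le> beta_star l1 l2 \<alpha>)"
proof -
  define a b where "a = - ln \<bar>l1\<bar>" and "b = ln \<bar>l2\<bar>"
  have ab: "0 < a" "0 < b"
    using assms by (auto simp: a_def b_def)
  have abs: "\<bar>ln \<bar>l1\<bar>\<bar> = a" "\<bar>ln \<bar>l2\<bar>\<bar> = b"
    using ab by (auto simp: a_def b_def)
  have sigma: "sigma l1 l2 = - (b / a)"
    by (simp add: sigma_def a_def b_def)
  define l where "l i = (if i = (1::2) then l1 else l2)" for i
  have l: "l 1 = l1" "l 2 = l2"
    by (simp_all add: l_def)
  note diag = diag2_mult_vec [of l1 l2, folded l_def]
  show ?thesis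
  proof (cases "\<bar>l1 * l2\<bar> \<le> 1")
    case True
    \<comment> \<open>Here \<open>b \<le> a\<close>, so the second axis serves as
      \<open>q\<close>.\<close>
    then have "beta_star l1 l2 \<alpha> = \<alpha> * b / (a + b)"
      using ab by (simp add: beta_star_def sigma field_simps)
    then show ?thesis
      using conjugacy_counterexample [of \<alpha> 1 2 l] assms unfolding diag by (simp add: l abs)
  next
    case False
    then have "beta_star l1 l2 \<alpha> = \<alpha> * a / (b + a)"
      using ab by (simp add: beta_star_def sigma field_simps)
    then show ?thesis
      using conjugacy_counterexample [of \<alpha> 2 1 l] assms unfolding diag by (simp add: l abs)
  qed
qed

end
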